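(* Let $(I,\mathcal I)$ be a measurable space, $(C_i)_{i\in I}$ a family of nonempty closed convex subsets of $X$ such that $i\mapsto C_i$ is a measurable set-valued mapping, $\xi$ an $I$-valued random variable on a probability space $(\Omega,\mathfrak A,\mathbb P)$, and $C=\{x\in X : x\in C_\xi\ \mathbb P\text{-a.s.}\}$, with $C\neq\varnothing$. Let $\phi$ be a Legendre function on $X$, $U=\operatorname{int}(\operatorname{dom}\phi)$, and suppose $C\ne X$, $\operatorname{dom}\phi^*$ is open, and $U\cap C\ne\varnothing$. Let $\overline D_C\colon U\to\mathbb R$, $\overline D_C(x)=\mathbb E[D_{C_\xi}(x)]$. Let $x_0\in U$ and let $(x_k)_{k\in\mathbb N}$ be generated by $x_{k+1}=P_{C_{\xi_k}}(x_k)$, where $(\xi_k)_{k\in\mathbb N}$ are $I$-valued random variables which are independent copies of $\xi$. Then: (i) The sequence $(x_k)_{k\in\mathbb N}$ is $\mathbb P$-a.s. $D$-Fejér monotone with respect to $C$ and $\mathbb P$-a.s. contained in a compact subset of $X$. (ii) $(D_C(x_k))_{k\in\mathbb N}$ is $\mathbb P$-a.s. decreasing and $\overline D_C(x_k)\to0$ $\mathbb P$-a.s. (iii) There exist an $X$-valued random variable $\hat x$ and a subsequence $(x_{n_k})_{k\in\mathbb N}$ such that $\hat x\in C\cap U$ $\mathbb P$-a.s. and $x_{n_k}\to\hat x$ in distribution. (iv) $D_C(x_k)\to0$ $\mathbb P$-a.s. and $\mathbb E[D_C(x_k)]\to0$. (v) Suppose that for all bounded sequences $(z_k)_{k\in\mathbb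 N}$ and $(y_k)_{k\in\mathbb N}$ in $U$, $D_\phi(z_k,y_k)\to0$ implies $z_k-y_k\to0$. Then there exists an $X$-valued random variable $\hat x$ such that $\hat x\in U\cap C$ $\mathbb P$-a.s., $x_k\to\hat x$ $\mathbb P$-a.s., and $\mathbb E[\|x_k-\hat x\|^2]\to0$.
   Context: $X$ is a Euclidean space (finite-dimensional real inner product space) with inner product $\langle\cdot,\cdot\rangle$ and norm $\|\cdot\|$. For $\phi\colon X\to\,]-\infty,+\infty]$, $\operatorname{dom}\phi=\{\phi<+\infty\}$ and $\phi^*(y)=\sup_{x\in X}(\langle x,y\rangle-\phi(x))$ is the Fenchel conjugate. A Legendre function is a proper closed convex function which is essentially smooth (differentiable on $\operatorname{int}(\operatorname{dom}\phi)\neq\varnothing$, with $\|\nabla\phi(x_n)\|\to+\infty$ whenever $x_n\in\operatorname{int}(\operatorname{dom}\phi)$ converges to a boundary point of $\operatorname{dom}\phi$) and essentially strictly convex ($\operatorname{int}(\operatorname{dom}\phi^* )\ne\varnothing$ and $\phi$ is strictly convex on every convex subset of $\operatorname{dom}\partial\phi$). Set $U=\operatorname{int}(\operatorname{dom}\phi)$. Bregman distance: $D_\phi(x,y)=\phi(x)-\phi(y)-\langle x-y,\nabla\phi(y)\rangle$ if $y\in U$, and $+\infty$ otherwise. For a closed convex set $S$ with $S\cap U\ne\varnothing$ and $x\in U$, the Bregman projection $P_S(x)$ is the unique minimizer of $D_\phi(\cdot,x)$ over $S$ (it lies in $S\cap U$), and $D_S(x)=\inf_{z\in S}D_\phi(z,x)=D_\phi(P_S(x),x)$.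 A sequence $(x_k)$ in $U$ is $D$-Fejér monotone w.r.t. $C$ if $D_\phi(x,x_{k+1})\le D_\phi(x,x_k)$ for all $x\in C$ and $k\in\mathbb N$. The set-valued map $i\mapsto C_i$ is measurable if $\{i\in I : C_i\cap Z\neq\varnothing\}\in\mathcal I$ for every Borel set $Z\subset X$. "Independent copies of $\xi$" means the $\xi_k$ are mutually independent with the same distribution as $\xi$; the starting point $x_0$ is deterministic. "Decreasing" means nonincreasing. *)

theory Defs
  imports "HOL-Probability.Probability"
begin

section \<open>Extended-valued convex functions\<close>

definition edom :: "('a \<Rightarrow> ereal) \<Rightarrow> 'a set" where
  "edom \<phi> = {x. \<phi> x < \<infinity>}"

definition ereal_epigraph :: "('a \<Rightarrow> ereal) \<Rightarrow> ('a \<times> real) set" where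
  "ereal_epigraph \<phi> = {(x, r). \<phi> x \<le> ereal r}"

definition proper_fun :: "('a \<Rightarrow> ereal) \<Rightarrow> bool" where
  "proper_fun \<phi> \<longleftrightarrow> (\<forall>x. \<phi> x \<noteq> -\<infinity>) \<and> edom \<phi> \<noteq> {}"

definition fenchel_conjugate :: "('a::real_inner \<Rightarrow> ereal) \<Rightarrow> 'a \<Rightarrow> ereal" where
  "fenchel_conjugate \<phi> y = (SUP x. ereal (x \<bullet> y) - \<phi> x)"

definition subdifferential :: "('a::real_inner \<Rightarrow> ereal) \<Rightarrow> 'a \<Rightarrow> 'a set" where
  "subdifferential \<phi> x = {u. \<forall>y. \<phi> x + ereal ((y - x) \<bullet> u) \<le> \<phi> y}"

definition strictly_convex_on :: "'a::real_vector set \<Rightarrow> ('a \<Rightarrow> ereal) \<Rightarrow> bool" where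
  "strictly_convex_on S \<phi> \<longleftrightarrow>
     (\<forall>x\<in>S. \<forall>y\<in>S. \<forall>t. x \<noteq> y \<and> 0 < t \<and> t < 1 \<longrightarrow>
        \<phi> ((1 - t) *\<^sub>R x + t *\<^sub>R y) < ereal (1 - t) * \<phi> x + ereal t * \<phi> y)"

text \<open>The gradient is only used at points of the interior of the domain, where the
  real-valued version of a proper \<open>\<phi>\<close> agrees with \<open>\<phi>\<close> in a neighbourhood.\<close>

definition ereal_grad :: "('a::real_inner \<Rightarrow> ereal) \<Rightarrow> 'a \<Rightarrow> 'a" where
  "ereal_grad \<phi> x = (THE g. GDERIV (\<lambda>z. real_of_ereal (\<phi> z)) x :> g)"

definition essentially_smooth :: "('a::euclidean_space \<Rightarrow> ereal) \<Rightarrow> bool" where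
  "essentially_smooth \<phi> \<longleftrightarrow>
     interior (edom \<phi>) \<noteq> {} \<and>
     (\<forall>x\<in>interior (edom \<phi>). (\<lambda>z. real_of_ereal (\<phi> z)) differentiable (at x)) \<and>
     (\<forall>s b. (\<forall>n. s n \<in> interior (edom \<phi>)) \<and> b \<in> frontier (edom \<phi>) \<and> s \<longlonglongrightarrow> b \<longrightarrow>
        filterlim (\<lambda>n. norm (ereal_grad \<phi> (s n))) at_top sequentially)"

definition essentially_strictly_convex :: "('a::euclidean_space \<Rightarrow> ereal) \<Rightarrow> bool" where
  "essentially_strictly_convex \<phi> \<longleftrightarrow>
     interior (edom (fenchel_conjugate \<phi>)) \<noteq> {} \<and>
     (\<forall>S. convex S \<and> S \<subseteq> {x. subdifferential \<phi> x \<noteq> {}} \<longrightarrow> strictly_convex_on S \<phi>)"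

definition legendre :: "('a::euclidean_space \<Rightarrow> ereal) \<Rightarrow> bool" where
  "legendre \<phi> \<longleftrightarrow>
     proper_fun \<phi> \<and> closed (ereal_epigraph \<phi>) \<and> convex (ereal_epigraph \<phi>) \<and>
     essentially_smooth \<phi> \<and> essentially_strictly_convex \<phi>"

section \<open>Bregman distances and projections\<close>

definition bregman_dist :: "('a::euclidean_space \<Rightarrow> ereal) \<Rightarrow> 'a \<Rightarrow> 'a \<Rightarrow> ereal" where
  "bregman_dist \<phi> x y =
     (if y \<in> interior (edom \<phi>) then \<phi> x - \<phi> y - ereal ((x - y) \<bullet> ereal_grad \<phi> y) else \<infinity>)"

definition bregman_dist_set :: "('a::euclidean_space \<Rightarrow> ereal) \<Rightarrow> 'a set \<Rightarrow> 'a \<Rightarrow> ereal" where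
  "bregman_dist_set \<phi> S x = (INF z\<in>S. bregman_dist \<phi> z x)"

text \<open>The projection is meant for \<open>x\<close> in the interior of the domain and for closed convex \<open>S\<close>
  meeting this interior, where the minimizer is unique. The other branch is a mere totalization.
  A random set whose a.s. intersection meets the interior of the domain leads to it only on a
  null event.\<close>

definition bregman_proj :: "('a::euclidean_space \<Rightarrow> ereal) \<Rightarrow> 'a set \<Rightarrow> 'a \<Rightarrow> 'a" where
  "bregman_proj \<phi> S x =
     (if x \<in> interior (edom \<phi>) \<and> S \<inter> interior (edom \<phi>) \<noteq> {}
      then (THE z. is_arg_min (\<lambda>z. bregman_dist \<phi> z x) (\<lambda>z. z \<in> S) z)
      else x)"

definition bregman_fejer :: "('a::euclidean_space \<Rightarrow> ereal) \<Rightarrow> 'a set \<Rightarrow> (nat \<Rightarrow> 'a) \<Rightarrow> bool" where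
  "bregman_fejer \<phi> C s \<longleftrightarrow>
     (\<forall>k. s k \<in> interior (edom \<phi>)) \<and>
     (\<forall>x\<in>C. \<forall>k. bregman_dist \<phi> x (s (Suc k)) \<le> bregman_dist \<phi> x (s k))"

section \<open>Random sets and random variables\<close>

definition measurable_set_valued :: "'i measure \<Rightarrow> ('i \<Rightarrow> 'a::topological_space set) \<Rightarrow> bool" where
  "measurable_set_valued I Cs \<longleftrightarrow>
     (\<forall>Z\<in>sets borel. {i \<in> space I. Cs i \<inter> Z \<noteq> {}} \<in> sets I)"

definition as_intersection :: "'w measure \<Rightarrow> ('i \<Rightarrow> 'a set) \<Rightarrow> ('w \<Rightarrow> 'i) \<Rightarrow> 'a set" where
  "as_intersection M Cs \<xi> = {x. AE \<omega> in M. x \<in> Cs (\<xi> \<omega>)}"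

text \<open>Bregman distances are nonnegative (for convex \<open>\<phi>\<close>), so their expectations are
  taken in \<open>[0, \<infinity>]\<close>.\<close>

definition mean_bregman_dist ::
    "('a::euclidean_space \<Rightarrow> ereal) \<Rightarrow> 'w measure \<Rightarrow> ('i \<Rightarrow> 'a set) \<Rightarrow> ('w \<Rightarrow> 'i) \<Rightarrow> 'a \<Rightarrow> ennreal" where
  "mean_bregman_dist \<phi> M Cs \<xi> x =
     (\<integral>\<^sup>+ \<omega>. e2ennreal (bregman_dist_set \<phi> (Cs (\<xi> \<omega>)) x) \<partial>M)"

text \<open>The library's weak convergence only covers real random variables.\<close>

definition converges_in_distribution ::
    "'w measure \<Rightarrow> (nat \<Rightarrow> 'w \<Rightarrow> 'a::topological_space) \<Rightarrow> ('w \<Rightarrow> 'a) \<Rightarrow> bool" where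
  "converges_in_distribution M X Y \<longleftrightarrow>
     (\<forall>n. X n \<in> borel_measurable M) \<and> Y \<in> borel_measurable M \<and>
     (\<forall>f::'a \<Rightarrow> real. continuous_on UNIV f \<and> bounded (range f) \<longrightarrow>
        (\<lambda>n. \<integral>\<omega>. f (X n \<omega>) \<partial>M) \<longlonglongrightarrow> (\<integral>\<omega>. f (Y \<omega>) \<partial>M))"

end

theory Submission
  imports Defs
begin

text \<open>
  The iterates converge almost surely to a point of \<open>C \<inter> U\<close>, and every other assertion about limits
  follows from this. Three facts carry the argument.

  \<^item> \<^emph>\<open>Compactness.\<close> For \<open>c \<in> U\<close> the sublevel sets of \<open>D(c, \<cdot>)\<close> are compact subsets of \<open>U\<close>
    (\<open>bregman_sublevel_compact\<close>). Bounded distance bounds the gradients and the conjugate at the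
    gradients; openness of \<open>dom \<phi>\<^sup>*\<close> keeps the limits of gradients in \<open>dom \<phi>\<^sup>*\<close>, where \<open>\<phi>\<close> minus a linear
    function is coercive, and essential smoothness keeps limit points away from the boundary of \<open>dom \<phi>\<close>.
    Coercivity and essential smoothness also give the existence of Bregman projections and their
    membership in \<open>U\<close>; strict convexity gives uniqueness.

  \<^item> \<^emph>\<open>Descent.\<close> The three-point inequality \<open>D(c, P\<^sub>S y) + D\<^sub>S(y) \<le> D(c, y)\<close> for \<open>c \<in> S\<close>
    (\<open>bregman_three_point\<close>) applies almost surely to all \<open>c \<in> C\<close> at once, because \<open>C\<close> is contained in
    almost every \<open>C\<^sub>\<xi>\<close> (test a countable dense subset of \<open>C\<close>). This is Fejer monotonicity. Summing it for one
    \<open>c\<^sub>0 \<in> C \<inter> U\<close> bounds the sum of the distances \<open>D\<^bsub>C_\<xi>_k\<^esub>(x\<^sub>k)\<close> by \<open>D(c\<^sub>0, x\<^sub>0)\<close>. As \<open>\<xi>\<^sub>k\<close> is independent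
    of \<open>x\<^sub>k\<close>, each summand has the same expectation as the mean distance at \<open>x\<^sub>k\<close>, so the mean distances have a
    finite sum almost surely and tend to zero.

  \<^item> \<^emph>\<open>Identification of the limit.\<close> If \<open>y \<in> U\<close> is outside a closed set \<open>S\<close>, then \<open>D\<^sub>S\<close> is bounded away from
    zero near \<open>y\<close> (\<open>bregman_dist_set_bounded_away\<close>). With Fatou's lemma, every cluster point of the iterates
    belongs to \<open>C\<close> (\<open>mean_zero_limit_in_C\<close>). The distance from such a cluster point \<open>y\<close> to \<open>x\<^sub>k\<close> decreases, and tends to
    zero along a subsequence, hence along the whole sequence, and on a compact subset of \<open>U\<close> this forces
    \<open>x\<^sub>k \<rightarrow> y\<close>.

  The iterates stay in one compact subset of \<open>U\<close>, so dominated convergence turns almost sure convergence into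
  convergence in distribution (along the full sequence), in mean square, and of the expected distances.

  Measurability of the iterates needs an argument of its own. The distance to a random set is shown to
  be measurable by writing its sublevel events as countable unions of hitting events of fixed Borel sets,
  and the event that a projection lies in a closed set \<open>Z\<close> is expressed by comparing the distances to \<open>S\<close> and \<open>S \<inter> Z\<close>.
\<close>

section \<open>Measurable set-valued maps\<close>

lemma measurable_set_valuedD:
  "measurable_set_valued N S \<Longrightarrow> Z \<in> sets borel \<Longrightarrow> {\<omega> \<in> space N. S \<omega> \<inter> Z \<noteq> {}} \<in> sets N"
  by (simp add: measurable_set_valued_def)

lemma measurable_set_valued_Int:
  "measurable_set_valued N S \<Longrightarrow> Z \<in> sets borel \<Longrightarrow> measurable_set_valued N (\<lambda>\<omega>. S \<omega> \<inter> Z)"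
  unfolding measurable_set_valued_def by (simp add: Int_assoc)

lemma measurable_set_valued_const: "measurable_set_valued N (\<lambda>\<omega>. S)"
  unfolding measurable_set_valued_def by (auto intro: sets.top)

lemma measurable_set_valued_compose:
  assumes "measurable_set_valued I S" "h \<in> measurable N I"
  shows "measurable_set_valued N (\<lambda>\<omega>. S (h \<omega>))"
  unfolding measurable_set_valued_def
proof
  fix Z :: "'b set" assume "Z \<in> sets borel"
  then have "h -` {i \<in> space I. S i \<inter> Z \<noteq> {}} \<inter> space N \<in> sets N"
    using assms by (intro measurable_sets[OF assms(2)] measurable_set_valuedD)
  also have "h -` {i \<in> space I. S i \<inter> Z \<noteq> {}} \<inter> space N = {\<omega> \<in> space N. S (h \<omega>) \<inter> Z \<noteq> {}}"
    using measurable_space[OF assms(2)] by auto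
  finally show "{\<omega> \<in> space N. S (h \<omega>) \<inter> Z \<noteq> {}} \<in> sets N" .
qed

section \<open>Legendre functions and their Bregman distances\<close>

locale legendre_function =
  fixes \<phi> :: "'a::euclidean_space \<Rightarrow> ereal"
  assumes legendre: "legendre \<phi>"
begin

abbreviation dom :: "'a set" where "dom \<equiv> edom \<phi>"
abbreviation U :: "'a set" where "U \<equiv> interior dom"
abbreviation grad :: "'a \<Rightarrow> 'a" where "grad \<equiv> ereal_grad \<phi>"

text \<open>The real-valued version of \<open>\<phi>\<close>, meaningful on \<open>dom\<close> only; outside of \<open>dom\<close> it has the junk value 0.\<close>

definition f :: "'a \<Rightarrow> real" where
  "f = (\<lambda>z. real_of_ereal (\<phi> z))"

definition breg :: "'a \<Rightarrow> 'a \<Rightarrow> real" where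
  "breg z y = f z - f y - (z - y) \<bullet> grad y"

lemma not_MInf: "\<phi> z \<noteq> -\<infinity>"
  using legendre by (auto simp: legendre_def proper_fun_def)

lemma domI: "\<phi> z \<le> ereal r \<Longrightarrow> z \<in> dom"
  by (auto simp: edom_def intro: le_less_trans)

lemma phi_dom: "z \<in> dom \<Longrightarrow> \<phi> z = ereal (f z)"
  using not_MInf[of z] by (cases "\<phi> z") (auto simp: edom_def f_def)

lemma phi_not_dom: "z \<notin> dom \<Longrightarrow> \<phi> z = \<infinity>"
  by (auto simp: edom_def)

lemma U_dom: "z \<in> U \<Longrightarrow> z \<in> dom"
  using interior_subset by blast

lemma f_convex:
  assumes "x \<in> dom" "y \<in> dom" "0 \<le> t" "t \<le> 1"
  shows "x + t *\<^sub>R (y - x) \<in> dom" and "f (x + t *\<^sub>R (y - x)) \<le> f x + t * (f y - f x)"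
proof -
  have "convex (ereal_epigraph \<phi>)"
    using legendre by (auto simp: legendre_def)
  moreover have "(x, f x) \<in> ereal_epigraph \<phi>" "(y, f y) \<in> ereal_epigraph \<phi>"
    using assms phi_dom by (auto simp: ereal_epigraph_def)
  ultimately have "(1 - t) *\<^sub>R (x, f x) + t *\<^sub>R (y, f y) \<in> ereal_epigraph \<phi>"
    using assms by (intro convexD) auto
  moreover have "(1 - t) *\<^sub>R (x, f x) + t *\<^sub>R (y, f y)
      = (x + t *\<^sub>R (y - x), f x + t * (f y - f x))"
    by (simp add: algebra_simps)
  ultimately have *: "\<phi> (x + t *\<^sub>R (y - x)) \<le> ereal (f x + t * (f y - f x))"
    by (simp add: ereal_epigraph_def)
  then show d: "x + t *\<^sub>R (y - x) \<in> dom" by (rule domI)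
  show "f (x + t *\<^sub>R (y - x)) \<le> f x + t * (f y - f x)"
    using * phi_dom[OF d] by simp
qed

lemma convex_dom: "convex dom"
  unfolding convex_alt using f_convex(1) by (auto simp: algebra_simps)

lemma convex_U: "convex U"
  by (intro convex_interior convex_dom)

lemma gderiv_grad:
  assumes "x \<in> U" shows "GDERIV f x :> grad x"
proof -
  have "f differentiable (at x)"
    using legendre assms by (auto simp: legendre_def essentially_smooth_def f_def)
  then obtain f' where f': "(f has_derivative f') (at x)"
    by (auto simp: differentiable_def)
  have "linear f'" using f' has_derivative_linear by blast
  have "f' = (\<lambda>h. h \<bullet> adjoint f' 1)"
    using adjoint_works[OF \<open>linear f'\<close>, of _ 1] by auto
  then have 1: "GDERIV f x :> adjoint f' 1"
    using f' unfolding gderiv_def by simp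
  have 2: "g = adjoint f' 1" if "GDERIV f x :> g" for g
  proof -
    have "(\<lambda>h. h \<bullet> g) = (\<lambda>h. h \<bullet> adjoint f' 1)"
      using that 1 unfolding gderiv_def by (rule has_derivative_unique)
    then show ?thesis by (metis inner_commute vector_eq_rdot)
  qed
  show ?thesis
    unfolding ereal_grad_def f_def[symmetric] by (rule theI[of "\<lambda>g. GDERIV f x :> g"]) (fact 1, fact 2)
qed

lemma f_continuous_at: "x \<in> U \<Longrightarrow> isCont f x"
  using gderiv_grad has_derivative_continuous unfolding gderiv_def by blast

lemma f_continuous_on: "continuous_on U f"
  by (simp add: continuous_at_imp_continuous_on f_continuous_at)

lemma directional_derivative:
  assumes "x \<in> U"
  shows "((\<lambda>t. (f (x + t *\<^sub>R h) - f x) / t) \<longlongrightarrow> h \<bullet> grad x) (at_right 0)"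
proof -
  have "((\<lambda>t. f (x + t *\<^sub>R h)) has_derivative (\<lambda>t. (t *\<^sub>R h) \<bullet> grad x)) (at 0)"
  proof (rule has_derivative_compose[where f = "\<lambda>t. x + t *\<^sub>R h" and f' = "\<lambda>t. t *\<^sub>R h" and g = f])
    show "((\<lambda>t. x + t *\<^sub>R h) has_derivative (\<lambda>t. t *\<^sub>R h)) (at 0)"
      by (auto intro!: derivative_eq_intros)
    show "(f has_derivative (\<lambda>k. k \<bullet> grad x)) (at (x + 0 *\<^sub>R h))"
      using gderiv_grad[OF assms] by (simp add: gderiv_def)
  qed
  moreover have "(\<lambda>t. (t *\<^sub>R h) \<bullet> grad x) = (*) (h \<bullet> grad x)"
    by (simp add: fun_eq_iff)
  ultimately have "((\<lambda>t. f (x + t *\<^sub>R h)) has_real_derivative (h \<bullet> grad x)) (at 0)"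
    by (simp only: has_field_derivative_def)
  then have "((\<lambda>t. (f (x + t *\<^sub>R h) - f x) / t) \<longlongrightarrow> h \<bullet> grad x) (at 0)"
    by (simp add: has_field_derivative_iff)
  then show ?thesis by (rule tendsto_within_subset) auto
qed

lemma gradient_inequality:
  assumes "x \<in> U" "z \<in> dom"
  shows "f x + (z - x) \<bullet> grad x \<le> f z"
proof -
  have "(z - x) \<bullet> grad x \<le> f z - f x"
  proof (rule tendsto_upperbound[OF directional_derivative[OF assms(1)]])
    have "(f (x + t *\<^sub>R (z - x)) - f x) / t \<le> f z - f x" if "0 < t" "t < 1" for t
      using f_convex(2)[OF U_dom[OF assms(1)] assms(2), of t] that by (simp add: field_simps)
    then show "\<forall>\<^sub>F t in at_right 0. (f (x + t *\<^sub>R (z - x)) - f x) / t \<le> f z - f x"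
      by (intro eventually_at_rightI[of 0 1]) auto
  qed auto
  then show ?thesis by simp
qed

lemma breg_nonneg: "y \<in> U \<Longrightarrow> z \<in> dom \<Longrightarrow> 0 \<le> breg z y"
  using gradient_inequality[of y z] by (simp add: breg_def)

lemma breg_self [simp]: "breg y y = 0"
  by (simp add: breg_def)

lemma bregman_dist_dom:
  "y \<in> U \<Longrightarrow> z \<in> dom \<Longrightarrow> bregman_dist \<phi> z y = ereal (breg z y)"
  using phi_dom[of z] phi_dom[OF U_dom, of y] by (simp add: bregman_dist_def breg_def)

lemma bregman_dist_infty:
  "z \<notin> dom \<or> y \<notin> U \<Longrightarrow> bregman_dist \<phi> z y = \<infinity>"
  using phi_not_dom[of z] phi_dom[OF U_dom, of y] by (auto simp: bregman_dist_def)

lemma bregman_dist_nonneg: "0 \<le> bregman_dist \<phi> z y"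
  using bregman_dist_dom bregman_dist_infty breg_nonneg
  by (cases "y \<in> U \<and> z \<in> dom") auto

text \<open>Essential strict convexity speaks of convex subsets of the domain of the subdifferential; \<open>U\<close> is one,
  since gradients are subgradients.\<close>

lemma f_strict_midpoint:
  assumes "x \<in> U" "y \<in> U" "x \<noteq> y"
  shows "f ((1/2) *\<^sub>R (x + y)) < (f x + f y) / 2"
proof -
  have "grad u \<in> subdifferential \<phi> u" if "u \<in> U" for u
    unfolding subdifferential_def
  proof (intro CollectI allI)
    fix z show "\<phi> u + ereal ((z - u) \<bullet> grad u) \<le> \<phi> z"
      using gradient_inequality[OF that, of z] phi_dom[of u] phi_dom[of z] phi_not_dom[of z] U_dom[OF that]
      by (cases "z \<in> dom") auto
  qed
  then have "strictly_convex_on U \<phi>"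
    using legendre convex_U unfolding legendre_def essentially_strictly_convex_def by blast
  then have "\<phi> ((1 - 1/2) *\<^sub>R x + (1/2) *\<^sub>R y) < ereal (1 - 1/2) * \<phi> x + ereal (1/2) * \<phi> y"
    using assms unfolding strictly_convex_on_def by (elim ballE allE[of _ "1/2"]) auto
  moreover have "(1/2) *\<^sub>R (x + y) \<in> dom"
    using convexD[OF convex_dom U_dom[OF assms(1)] U_dom[OF assms(2)], of "1/2" "1/2"]
    by (simp add: scaleR_add_right)
  ultimately show ?thesis
    using phi_dom[OF U_dom[OF assms(1)]] phi_dom[OF U_dom[OF assms(2)]] phi_dom[of "(1/2) *\<^sub>R (x + y)"]
    by (simp add: scaleR_add_right)
qed

lemma breg_pos:
  assumes "z \<in> U" "y \<in> U" "z \<noteq> y" shows "0 < breg z y"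
proof -
  let ?m = "(1/2) *\<^sub>R (z + y)"
  have "?m \<in> dom"
    using convexD[OF convex_dom U_dom[OF assms(1)] U_dom[OF assms(2)], of "1/2" "1/2"]
    by (simp add: scaleR_add_right)
  then have "f y + (?m - y) \<bullet> grad y \<le> f ?m"
    using gradient_inequality assms by blast
  moreover have "?m - y = (1/2) *\<^sub>R (z - y)"
    by (simp add: euclidean_eq_iff[where 'a = 'a] inner_simps field_simps)
  ultimately show ?thesis
    using f_strict_midpoint[OF assms] by (simp add: breg_def)
qed

text \<open>A differentiable convex function is continuously differentiable. For \<open>w\<close> near \<open>y\<close>, the gradient inequality at
  \<open>w\<close>, tested in the direction of \<open>grad w - grad y\<close>, bounds the norm of this difference by the first-order error of
  \<open>f\<close> at \<open>y\<close> and by \<open>f w - f y\<close>, up to a term that the left side absorbs.\<close>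

lemma grad_continuous_at:
  assumes "y \<in> U" shows "isCont grad y"
  unfolding isCont_def tendsto_iff eventually_at
proof (intro allI impI)
  fix e :: real assume "0 < e"
  have "(f has_derivative (\<lambda>h. h \<bullet> grad y)) (at y)"
    using gderiv_grad[OF assms] by (simp add: gderiv_def)
  then obtain d where "0 < d" and
    d: "\<And>z. norm (z - y) < d \<Longrightarrow> \<bar>f z - f y - (z - y) \<bullet> grad y\<bar> \<le> e / 8 * norm (z - y)"
    using \<open>0 < e\<close> unfolding has_derivative_at_alt by (auto dest!: spec[of _ "e / 8"])
  obtain d' where "0 < d'" and d': "ball y d' \<subseteq> U"
    using assms open_contains_ball[of U] by auto
  \<comment> \<open>The first-order error is at most \<open>e r / 8\<close> on the sphere of radius \<open>r\<close>; three such errors sum to less than \<open>e r / 2\<close>.\<close>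
  define r where "r = min d d' / 2"
  have r: "0 < r" "r < d" "r < d'"
    using \<open>0 < d\<close> \<open>0 < d'\<close> by (auto simp: r_def)
  have "0 < e * r / 8" using \<open>0 < e\<close> r by simp
  then obtain d1 where "0 < d1" and d1: "\<And>w. dist w y < d1 \<Longrightarrow> \<bar>f w - f y\<bar> < e * r / 8"
    using f_continuous_at[OF assms] unfolding continuous_at_eps_delta dist_real_def by blast
  define d2 where "d2 = e * r / (8 * (norm (grad y) + 1))"
  have "0 < norm (grad y) + 1" by (simp add: add_nonneg_pos)
  then have "0 < d2" using \<open>0 < e\<close> r by (simp add: d2_def)
  have "norm (grad w - grad y) < e" if w: "dist w y < Min {d1, d2, r / 2}" for w
  proof (cases "grad w = grad y")
    case False
    define a where "a = norm (grad w - grad y)"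
    have "0 < a" using False by (simp add: a_def)
    define h where "h = (r / a) *\<^sub>R (grad w - grad y)"
    have nh: "norm h = r" using \<open>0 < a\<close> r by (simp add: h_def a_def[symmetric])
    have ha: "h \<bullet> (grad w - grad y) = r * a"
      using \<open>0 < a\<close> by (simp add: h_def power2_norm_eq_inner[symmetric] a_def[symmetric] power2_eq_square)
    have "w \<in> U" using w d' r by (auto simp: dist_commute subset_iff)
    have "y + h \<in> U" using nh d' r by (auto simp: dist_norm subset_iff)
    have 1: "f w + (y + h - w) \<bullet> grad w \<le> f (y + h)"
      using gradient_inequality[OF \<open>w \<in> U\<close> U_dom[OF \<open>y + h \<in> U\<close>]] .
    have 2: "f (y + h) \<le> f y + h \<bullet> grad y + e / 8 * r"
      using d[of "y + h"] nh r unfolding abs_le_iff by simp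
    have 3: "\<bar>f w - f y\<bar> < e * r / 8" using d1 w by simp
    have 4: "(w - y) \<bullet> grad w \<le> norm (w - y) * a + norm (w - y) * norm (grad y)"
    proof -
      have "(w - y) \<bullet> grad w \<le> norm (w - y) * norm (grad w)" by (rule norm_cauchy_schwarz)
      also have "\<dots> \<le> norm (w - y) * (a + norm (grad y))"
        unfolding a_def using norm_triangle_sub[of "grad w" "grad y"]
        by (intro mult_left_mono) auto
      finally show ?thesis by (simp add: algebra_simps)
    qed
    have 5: "norm (w - y) * a \<le> r / 2 * a"
      using w \<open>0 < a\<close> by (intro mult_right_mono) (auto simp: dist_norm)
    have 6: "norm (w - y) * norm (grad y) \<le> e * r / 8"
    proof -
      have "norm (w - y) * norm (grad y) \<le> d2 * (norm (grad y) + 1)"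
        using w \<open>0 < d2\<close> by (intro mult_mono) (auto simp: dist_norm)
      also have "\<dots> = e * r / 8" using \<open>0 < norm (grad y) + 1\<close> by (simp add: d2_def field_simps)
      finally show ?thesis .
    qed
    have "r * a < e * r / 2 + r / 2 * a"
    proof -
      have "r * a = (y + h - w) \<bullet> grad w + (w - y) \<bullet> grad w - h \<bullet> grad y"
        using ha by (simp add: inner_simps)
      then show ?thesis
        using 1 2 abs_ge_minus_self[of "f w - f y"] 3 4 5 6 mult_pos_pos[OF \<open>0 < e\<close> r(1)] by linarith
    qed
    then have "r * a < r * e" by (simp add: field_simps)
    then show ?thesis using r by (simp add: a_def)
  qed (use \<open>0 < e\<close> in simp)
  then show "\<exists>d>0. \<forall>w\<in>UNIV. w \<noteq> y \<and> dist w y < d \<longrightarrow> dist (grad w) (grad y) < e"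
    using \<open>0 < d1\<close> \<open>0 < d2\<close> r by (intro exI[of _ "Min {d1, d2, r / 2}"]) (auto simp: dist_norm)
qed

lemma grad_continuous_on: "continuous_on U grad"
  by (simp add: continuous_at_imp_continuous_on grad_continuous_at)

lemma breg_continuous: "continuous_on (U \<times> U) (\<lambda>p. breg (fst p) (snd p))"
  unfolding breg_def
  by (intro continuous_intros continuous_on_compose2[OF f_continuous_on]
      continuous_on_compose2[OF grad_continuous_on]) auto

lemma breg_tendsto:
  assumes "z \<in> U" "y \<in> U" "(a \<longlongrightarrow> z) F" "(b \<longlongrightarrow> y) F"
  shows "((\<lambda>n. breg (a n) (b n)) \<longlongrightarrow> breg z y) F"
  unfolding breg_def
  by (intro tendsto_intros assms isCont_tendsto_compose[OF f_continuous_at]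
      isCont_tendsto_compose[OF grad_continuous_at])

lemma bounded_above_near_interior:
  assumes "c \<in> U"
  obtains e B where "0 < e" "cball c e \<subseteq> U" "\<And>z. z \<in> cball c e \<Longrightarrow> f z \<le> B"
proof -
  obtain e where e: "0 < e" "cball c e \<subseteq> U"
    using assms open_contains_cball[of U] by auto
  have "compact (f ` cball c e)"
    using e f_continuous_on by (intro compact_continuous_image) (auto intro: continuous_on_subset)
  then have "bdd_above (f ` cball c e)"
    by (intro bounded_imp_bdd_above compact_imp_bounded)
  then obtain B where "\<And>z. z \<in> cball c e \<Longrightarrow> f z \<le> B"
    unfolding bdd_above_def by blast
  then show thesis using e that by blast
qed

text \<open>The gradient inequality at \<open>y\<close>, tested at the point of the ball farthest from the center \<open>c\<close> in the direction of
  \<open>grad y\<close>. Large gradients must thus point away from \<open>c\<close>.\<close>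

lemma gradient_growth:
  assumes "cball c e \<subseteq> U" "0 \<le> e" "\<And>z. z \<in> cball c e \<Longrightarrow> f z \<le> B" "y \<in> U"
  shows "f y + (c - y) \<bullet> grad y + e * norm (grad y) \<le> B"
proof -
  let ?w = "c + e *\<^sub>R sgn (grad y)"
  have "?w \<in> cball c e"
    using assms(2) by (simp add: dist_norm norm_sgn)
  then have "f y + (?w - y) \<bullet> grad y \<le> B"
    using gradient_inequality[OF assms(4), of ?w] assms(1) assms(3)[of ?w] U_dom[of ?w] by force
  moreover have "sgn (grad y) \<bullet> grad y = norm (grad y)"
    by (cases "grad y = 0") (simp_all add: sgn_div_norm power2_norm_eq_inner[symmetric] power2_eq_square)
  ultimately show ?thesis by (simp add: algebra_simps inner_simps)
qed

lemma gradient_blows_up: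
  assumes "\<And>n. s n \<in> U" "b \<in> frontier dom" "s \<longlonglongrightarrow> b"
  shows "filterlim (\<lambda>n. norm (grad (s n))) at_top sequentially"
proof -
  have "essentially_smooth \<phi>" using legendre by (simp add: legendre_def)
  then show ?thesis
    unfolding essentially_smooth_def using assms by (elim conjE allE[of _ s] allE[of _ b]) simp
qed

lemma edom_conjugateI:
  assumes "\<And>z. z \<in> dom \<Longrightarrow> z \<bullet> v - f z \<le> b"
  shows "v \<in> edom (fenchel_conjugate \<phi>)"
proof -
  have "fenchel_conjugate \<phi> v \<le> ereal b"
    unfolding fenchel_conjugate_def
  proof (rule SUP_least)
    fix z show "ereal (z \<bullet> v) - \<phi> z \<le> ereal b"
      using assms[of z] phi_dom[of z] phi_not_dom[of z] by (cases "z \<in> dom") auto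
  qed
  then show ?thesis by (auto simp: edom_def intro: le_less_trans)
qed

lemma edom_conjugateD:
  assumes "v \<in> edom (fenchel_conjugate \<phi>)"
  obtains b where "\<And>z. z \<in> dom \<Longrightarrow> z \<bullet> v - f z \<le> b"
proof -
  have "fenchel_conjugate \<phi> v < \<infinity>" using assms by (simp add: edom_def)
  then obtain b where b: "fenchel_conjugate \<phi> v \<le> ereal b"
    by (cases "fenchel_conjugate \<phi> v") auto
  have "z \<bullet> v - f z \<le> b" if "z \<in> dom" for z
  proof -
    have "ereal (z \<bullet> v) - \<phi> z \<le> fenchel_conjugate \<phi> v"
      unfolding fenchel_conjugate_def by (rule SUP_upper) simp
    then have "ereal (z \<bullet> v) - ereal (f z) \<le> ereal b"
      using b phi_dom[OF that] by (metis order_trans)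
    then show ?thesis by simp
  qed
  then show thesis using that by blast
qed

lemma grad_in_edom_conjugate:
  assumes "y \<in> U" shows "grad y \<in> edom (fenchel_conjugate \<phi>)"
  using gradient_inequality[OF assms]
  by (intro edom_conjugateI[of _ "y \<bullet> grad y - f y"]) (force simp: inner_diff_left)

lemma bregman_dist_set_nonneg: "0 \<le> bregman_dist_set \<phi> S y"
  unfolding bregman_dist_set_def by (intro INF_greatest bregman_dist_nonneg)

text \<open>By continuity and compactness, \<open>D(z, w)\<close> has a positive minimum over \<open>z\<close> on a small sphere around \<open>y\<close> and \<open>w\<close>
  in a smaller ball. A segment from such \<open>w\<close> to a point of \<open>S\<close> crosses the sphere, and \<open>D(\<cdot>, w)\<close> is convex with
  value zero at \<open>w\<close>, so it is at least as large at the far end as at the crossing point.\<close>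

lemma bregman_dist_set_bounded_away:
  assumes y: "y \<in> U" and S: "closed S" "y \<notin> S"
  obtains r e where "0 < r" "0 < e" "\<And>w. w \<in> ball y r \<Longrightarrow> ereal e \<le> bregman_dist_set \<phi> S w"
proof -
  have "open (U - S)" "y \<in> U - S" using assms by auto
  then obtain r where r: "0 < r" "cball y r \<subseteq> U - S"
    using open_contains_cball by blast
  let ?Q = "sphere y r \<times> cball y (r / 2)"
  have sub: "sphere y r \<subseteq> U" "cball y (r / 2) \<subseteq> U"
    using r by (auto simp: subset_iff)
  have Qcont: "continuous_on ?Q (\<lambda>p. breg (fst p) (snd p))"
    by (rule continuous_on_subset[OF breg_continuous]) (use sub in auto)
  have "sphere y r \<noteq> {}" using r(1) by simp
  then have "?Q \<noteq> {}" using r(1) by auto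
  moreover have "compact ?Q" by (intro compact_Times) auto
  ultimately obtain q where q: "q \<in> ?Q" "\<And>p. p \<in> ?Q \<Longrightarrow> breg (fst q) (snd q) \<le> breg (fst p) (snd p)"
    using continuous_attains_inf[OF _ _ Qcont] by blast
  define e where "e = breg (fst q) (snd q)"
  have "fst q \<noteq> snd q" using q(1) r(1) by (cases q) auto
  then have "0 < e"
    unfolding e_def using q(1) sub by (intro breg_pos) (cases q; auto)+
  have "ereal e \<le> bregman_dist_set \<phi> S w" if w: "w \<in> ball y (r / 2)" for w
    unfolding bregman_dist_set_def
  proof (rule INF_greatest)
    fix z assume "z \<in> S"
    have wU: "w \<in> U" using w sub by auto
    show "ereal e \<le> bregman_dist \<phi> z w"
    proof (cases "z \<in> dom")
      case True
      have "z \<notin> cball y r" using r \<open>z \<in> S\<close> by blast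
      then have "closed_segment w z \<inter> frontier (cball y r) \<noteq> {}"
        using w r(1) by (intro connected_Int_frontier) auto
      then obtain u where "u \<in> closed_segment w z" "u \<in> sphere y r"
        using r(1) by (metis IntE all_not_in_conv frontier_cball)
      moreover from this(1) obtain t where t: "0 \<le> t" "t \<le> 1" "u = (1 - t) *\<^sub>R w + t *\<^sub>R z"
        unfolding in_segment by blast
      moreover have "(1 - t) *\<^sub>R w + t *\<^sub>R z = w + t *\<^sub>R (z - w)"
        by (simp add: algebra_simps)
      ultimately have t: "0 \<le> t" "t \<le> 1" "w + t *\<^sub>R (z - w) \<in> sphere y r"
        by simp_all
      let ?u = "w + t *\<^sub>R (z - w)"
      have "e \<le> breg ?u w"
        using q(2)[of "(?u, w)"] t w by (simp add: e_def)
      also have "\<dots> \<le> t * breg z w"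
        using f_convex(2)[OF U_dom[OF wU] True t(1,2)] by (simp add: breg_def algebra_simps)
      also have "\<dots> \<le> breg z w"
        using breg_nonneg[OF wU True] t by (simp add: mult_left_le_one_le)
      finally show ?thesis using wU True by (simp add: bregman_dist_dom)
    qed (simp add: bregman_dist_infty)
  qed
  then show thesis using that[of "r / 2" e] r(1) \<open>0 < e\<close> by auto
qed

text \<open>Away from \<open>y\<close>, the positive continuous function \<open>D(y, \<cdot>)\<close> has a positive minimum on the compact set.\<close>

lemma breg_tendsto_zero_imp_tendsto:
  assumes K: "compact K" "K \<subseteq> U" and y: "y \<in> U" and s: "\<And>n. s n \<in> K"
    and lim: "(\<lambda>n. breg y (s n)) \<longlonglongrightarrow> 0"
  shows "s \<longlonglongrightarrow> y"
  unfolding tendsto_iff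
proof (intro allI impI)
  fix e :: real assume "0 < e"
  show "\<forall>\<^sub>F n in sequentially. dist (s n) y < e"
  proof (cases "K - ball y e = {}")
    case True
    then have "s n \<in> ball y e" for n using s by blast
    then show ?thesis by (simp add: dist_commute)
  next
    case False
    have "compact (K - ball y e)" using K(1) by (simp add: compact_diff)
    moreover have "continuous_on (K - ball y e) (\<lambda>w. breg y w)"
      using continuous_on_compose2[OF breg_continuous, of "K - ball y e" "\<lambda>w. (y, w)"] y K(2)
      by (auto simp: continuous_on_Pair)
    ultimately obtain q where q: "q \<in> K - ball y e" "\<And>w. w \<in> K - ball y e \<Longrightarrow> breg y q \<le> breg y w"
      using continuous_attains_inf[of "K - ball y e" "\<lambda>w. breg y w"] False by blast
    have "0 < breg y q" using q(1) K(2) y \<open>0 < e\<close> by (intro breg_pos) auto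
    then have "\<forall>\<^sub>F n in sequentially. breg y (s n) < breg y q"
      using lim by (rule order_tendstoD(2)[rotated])
    then show ?thesis
    proof eventually_elim
      case (elim n)
      then have "s n \<notin> K - ball y e" using q(2)[of "s n"] by linarith
      then show ?case using s by (simp add: dist_commute)
    qed
  qed
qed

lemma phi_measurable [measurable]: "\<phi> \<in> borel_measurable borel"
proof (rule borel_measurableI_le)
  fix y :: ereal
  show "{z \<in> space borel. \<phi> z \<le> y} \<in> sets borel"
  proof (cases y)
    case (real r)
    have "closed ((\<lambda>z. (z, r)) -` ereal_epigraph \<phi>)"
      using legendre by (intro closed_vimage continuous_intros) (simp add: legendre_def)
    moreover have "(\<lambda>z. (z, r)) -` ereal_epigraph \<phi> = {z. \<phi> z \<le> y}"
      using real by (auto simp: ereal_epigraph_def)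
    ultimately show ?thesis by simp
  qed (use not_MInf in auto)
qed

lemma f_measurable [measurable]: "f \<in> borel_measurable borel"
  unfolding f_def by measurable

lemma U_borel [measurable]: "U \<in> sets borel"
  by simp

text \<open>For fixed \<open>x\<close>, the event that the distance is below \<open>b\<close> means that \<open>S\<close> hits a fixed Borel set. For random \<open>x\<close>
  the gradient \<open>v\<close> at \<open>x\<close> is replaced by nearby points \<open>q\<close> of a countable dense set. On points \<open>z\<close> of norm at most
  \<open>R\<close> the resulting error is at most \<open>R |v - q|\<close>, which separates the condition on \<open>S\<close> from the condition on \<open>x\<close>.\<close>

lemma bregman_dist_set_measurable:
  assumes S: "measurable_set_valued N S" and x[measurable]: "x \<in> borel_measurable N"
  shows "(\<lambda>\<omega>. bregman_dist_set \<phi> (S \<omega>) (x \<omega>)) \<in> borel_measurable N"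
proof (rule borel_measurableI_less)
  fix b :: ereal
  obtain Q :: "'a set" where Q: "countable Q" "\<And>X. open X \<Longrightarrow> X \<noteq> {} \<Longrightarrow> \<exists>q\<in>Q. q \<in> X"
    using countable_dense_setE by blast
  have "(\<lambda>y. indicator U y *\<^sub>R grad y) \<in> borel_measurable borel"
    by (intro borel_measurable_continuous_on_indicator grad_continuous_on) simp
  from measurable_compose[OF x this]
  have gx[measurable]: "(\<lambda>\<omega>. indicator U (x \<omega>) *\<^sub>R grad (x \<omega>)) \<in> borel_measurable N" .
  \<comment> \<open>The gradient is continuous on \<open>U\<close>; cutting it off outside makes it Borel on the whole space.\<close>
  define v where "v \<omega> = indicator U (x \<omega>) *\<^sub>R grad (x \<omega>)" for \<omega>
  have v[measurable]: "v \<in> borel_measurable N" unfolding v_def[abs_def] by (rule gx)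
  define k where "k \<omega> = x \<omega> \<bullet> v \<omega> - f (x \<omega>)" for \<omega>
  have k[measurable]: "k \<in> borel_measurable N" unfolding k_def[abs_def] by measurable
  define Z where "Z R q \<beta> = {z :: 'a. norm z \<le> real R \<and> \<phi> z - ereal (z \<bullet> q) < ereal (of_rat \<beta>)}" for R q \<beta>
  have Z: "Z R q \<beta> \<in> sets borel" for R q \<beta>
    unfolding Z_def by measurable
  define W where "W R q \<beta> = {\<omega> \<in> space N. x \<omega> \<in> U \<and> ereal (of_rat \<beta> + real R * norm (v \<omega> - q) + k \<omega>) < b}" for R q \<beta>
  have W: "W R q \<beta> \<in> sets N" for R q \<beta>
    unfolding W_def by measurable
  have "{\<omega> \<in> space N. bregman_dist_set \<phi> (S \<omega>) (x \<omega>) < b} =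
     (\<Union>R. \<Union>q\<in>Q. \<Union>\<beta>. {\<omega> \<in> space N. S \<omega> \<inter> Z R q \<beta> \<noteq> {}} \<inter> W R q \<beta>)" (is "?L = ?R")
  proof (intro equalityI subsetI)
    fix \<omega> assume "\<omega> \<in> ?L"
    then have \<omega>: "\<omega> \<in> space N" and "\<exists>z\<in>S \<omega>. bregman_dist \<phi> z (x \<omega>) < b"
      by (auto simp: bregman_dist_set_def INF_less_iff)
    then obtain z where z: "z \<in> S \<omega>" "bregman_dist \<phi> z (x \<omega>) < b" by blast
    from z(2) have "bregman_dist \<phi> z (x \<omega>) \<noteq> \<infinity>" by auto
    then have zx: "z \<in> dom" "x \<omega> \<in> U" using bregman_dist_infty by blast+
    then have vx: "v \<omega> = grad (x \<omega>)" by (simp add: v_def)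
    obtain r where r: "breg z (x \<omega>) < r" "ereal r < b"
      using z(2) zx ereal_dense2[of "ereal (breg z (x \<omega>))" b] by (auto simp: bregman_dist_dom)
    define e where "e = (r - breg z (x \<omega>)) / 3"
    have "0 < e" using r by (simp add: e_def)
    obtain R :: nat where R: "norm z \<le> real R" using real_arch_simple by blast
    define d where "d = e / (real R + 1)"
    have d: "0 < d" "real R * d \<le> e" using \<open>0 < e\<close> by (auto simp: d_def field_simps)
    obtain q where q: "q \<in> Q" "norm (v \<omega> - q) < d"
      using Q(2)[of "ball (v \<omega>) d"] d(1) by (auto simp: dist_norm)
    have Rq: "real R * norm (v \<omega> - q) \<le> e"
      using d(2) mult_left_mono[of "norm (v \<omega> - q)" d "real R"] q(2) by simp
    obtain \<beta> where \<beta>: "f z - z \<bullet> q < of_rat \<beta>" "of_rat \<beta> < f z - z \<bullet> q + e"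
      using of_rat_dense[of "f z - z \<bullet> q" "f z - z \<bullet> q + e"] \<open>0 < e\<close> by auto
    have "z \<in> Z R q \<beta>"
      using R \<beta>(1) phi_dom[OF zx(1)] by (simp add: Z_def)
    moreover have "\<omega> \<in> W R q \<beta>"
    proof -
      have "z \<bullet> (v \<omega> - q) \<le> norm z * norm (v \<omega> - q)" by (rule norm_cauchy_schwarz)
      also have "\<dots> \<le> real R * norm (v \<omega> - q)" using R by (intro mult_right_mono) auto
      finally have "z \<bullet> v \<omega> - z \<bullet> q \<le> e" using Rq by (simp add: inner_diff_right)
      then have "of_rat \<beta> + real R * norm (v \<omega> - q) + k \<omega> < breg z (x \<omega>) + 3 * e"
        using \<beta>(2) Rq vx by (simp add: breg_def k_def inner_diff_left)
      also have "\<dots> = r" by (simp add: e_def field_simps)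
      finally have "ereal (of_rat \<beta> + real R * norm (v \<omega> - q) + k \<omega>) < b"
        using r(2) by (meson ereal_less(3) less_ereal.simps(1) less_trans)
      then show ?thesis using \<omega> zx by (simp add: W_def)
    qed
    ultimately show "\<omega> \<in> ?R" using \<omega> z(1) q(1) by blast
  next
    fix \<omega> assume "\<omega> \<in> ?R"
    then obtain R q \<beta> z where \<omega>: "\<omega> \<in> space N" "z \<in> S \<omega>" "z \<in> Z R q \<beta>" "\<omega> \<in> W R q \<beta>" by blast
    then have zR: "norm z \<le> real R" and zq: "\<phi> z - ereal (z \<bullet> q) < ereal (of_rat \<beta>)"
      and xU: "x \<omega> \<in> U" and b: "ereal (of_rat \<beta> + real R * norm (v \<omega> - q) + k \<omega>) < b"
      by (auto simp: Z_def W_def)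
    have vx: "v \<omega> = grad (x \<omega>)" using xU by (simp add: v_def)
    have zd: "z \<in> dom" using zq phi_not_dom[of z] by (cases "z \<in> dom") auto
    have "z \<bullet> (q - v \<omega>) \<le> norm z * norm (q - v \<omega>)" by (rule norm_cauchy_schwarz)
    also have "\<dots> \<le> real R * norm (v \<omega> - q)"
      using zR by (subst norm_minus_commute) (intro mult_right_mono, auto)
    finally have "breg z (x \<omega>) \<le> of_rat \<beta> + real R * norm (v \<omega> - q) + k \<omega>"
      using zq phi_dom[OF zd] vx by (simp add: breg_def k_def inner_diff_left inner_diff_right)
    then have "bregman_dist \<phi> z (x \<omega>) < b"
      using b zd xU by (simp add: bregman_dist_dom) (meson ereal_less_eq(3) le_less_trans)
    then show "\<omega> \<in> ?L"
      using \<omega> unfolding bregman_dist_set_def by (auto simp: INF_less_iff)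
  qed
  also have "\<dots> \<in> sets N"
    using Q(1) W measurable_set_valuedD[OF S Z] by (intro sets.countable_UN'' sets.countable_UN' sets.Int) auto
  finally show "{\<omega> \<in> space N. bregman_dist_set \<phi> (S \<omega>) (x \<omega>) < b} \<in> sets N" .
qed

end

section \<open>Bregman projections when the domain of the conjugate is open\<close>

locale legendre_open_conjugate = legendre_function +
  assumes conj_open: "open (edom (fenchel_conjugate \<phi>))"
begin

text \<open>The conjugate is finite at \<open>v \<plusminus> e b\<close> for every basis vector \<open>b\<close>, which gives \<open>f z - z \<bullet> v \<ge> e |z \<bullet> b| - k\<^sub>b\<close>.
  Averaging over the basis bounds \<open>f z - z \<bullet> v\<close> below by a multiple of the norm of \<open>z\<close> minus a constant.\<close>

lemma coercive:
  assumes "v \<in> edom (fenchel_conjugate \<phi>)"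
  obtains d K where "0 < d" "\<And>z. z \<in> dom \<Longrightarrow> z \<bullet> v + d * norm z - K \<le> f z"
proof -
  obtain e where "0 < e" and e: "cball v e \<subseteq> edom (fenchel_conjugate \<phi>)"
    using conj_open assms open_contains_cball by blast
  have "\<exists>k. \<forall>b\<in>Basis. \<forall>z\<in>dom. z \<bullet> (v + e *\<^sub>R b) - f z \<le> k b \<and> z \<bullet> (v - e *\<^sub>R b) - f z \<le> k b"
  proof (intro bchoice ballI)
    fix b :: 'a assume "b \<in> Basis"
    then have "v + e *\<^sub>R b \<in> edom (fenchel_conjugate \<phi>)" "v - e *\<^sub>R b \<in> edom (fenchel_conjugate \<phi>)"
      using e \<open>0 < e\<close> by (auto simp: subset_iff dist_norm)
    then obtain k1 k2 where "\<And>z. z \<in> dom \<Longrightarrow> z \<bullet> (v + e *\<^sub>R b) - f z \<le> k1"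
      "\<And>z. z \<in> dom \<Longrightarrow> z \<bullet> (v - e *\<^sub>R b) - f z \<le> k2"
      by (metis edom_conjugateD)
    then show "\<exists>k. \<forall>z\<in>dom. z \<bullet> (v + e *\<^sub>R b) - f z \<le> k \<and> z \<bullet> (v - e *\<^sub>R b) - f z \<le> k"
      by (intro exI[of _ "max k1 k2"]) (auto intro: le_max_iff_disj[THEN iffD2])
  qed
  then obtain k where k: "\<And>b z. b \<in> Basis \<Longrightarrow> z \<in> dom \<Longrightarrow> z \<bullet> (v + e *\<^sub>R b) - f z \<le> k b"
      "\<And>b z. b \<in> Basis \<Longrightarrow> z \<in> dom \<Longrightarrow> z \<bullet> (v - e *\<^sub>R b) - f z \<le> k b"
    by blast
  define n where "n = real DIM('a)"
  have n: "0 < n" by (simp add: n_def)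
  show thesis
  proof
    show "0 < e / n" using \<open>0 < e\<close> n by simp
    fix z assume z: "z \<in> dom"
    have "e * \<bar>z \<bullet> b\<bar> \<le> k b + (f z - z \<bullet> v)" if "b \<in> Basis" for b
      using k[OF that z] \<open>0 < e\<close> by (simp add: inner_simps abs_if)
    then have "(\<Sum>b\<in>Basis. e * \<bar>z \<bullet> b\<bar>) \<le> (\<Sum>b\<in>Basis. k b + (f z - z \<bullet> v))"
      by (rule sum_mono)
    then have "e * (\<Sum>b\<in>Basis. \<bar>z \<bullet> b\<bar>) \<le> sum k Basis + n * (f z - z \<bullet> v)"
      by (simp add: sum_distrib_left sum.distrib n_def)
    moreover have "e * norm z \<le> e * (\<Sum>b\<in>Basis. \<bar>z \<bullet> b\<bar>)"
      using norm_le_l1[of z] \<open>0 < e\<close> by simp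
    ultimately have "e * norm z \<le> sum k Basis + n * (f z - z \<bullet> v)" by simp
    then have "e * norm z / n \<le> (sum k Basis + n * (f z - z \<bullet> v)) / n"
      using n by (simp add: divide_right_mono)
    then show "z \<bullet> v + e / n * norm z - sum k Basis / n \<le> f z"
      using n by (simp add: add_divide_distrib)
  qed
qed

text \<open>Sequential compactness. The gradients along a sequence of the sublevel set are bounded; a limit \<open>v\<close> of
  them lies in \<open>dom \<phi>\<^sup>*\<close> by lower semicontinuity of the conjugate. Coercivity at \<open>v\<close> bounds the sequence itself, and
  a limit on the boundary of \<open>dom\<close> would make the gradients blow up.\<close>

lemma bregman_sublevel_compact:
  assumes c: "c \<in> U"
  shows "compact {y \<in> U. breg c y \<le> b}"
proof -
  let ?A = "{y \<in> U. breg c y \<le> b}"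
  obtain e B where e: "0 < e" "cball c e \<subseteq> U" "\<And>z. z \<in> cball c e \<Longrightarrow> f z \<le> B"
    using bounded_above_near_interior[OF c] by blast
  have grad_bound: "norm (grad y) \<le> (B - f c + b) / e" if "y \<in> ?A" for y
    using gradient_growth[OF e(2) _ e(3), of y] that e(1)
    by (simp add: breg_def field_simps inner_diff_left)
  have "\<exists>l\<in>?A. \<exists>r. strict_mono r \<and> (s \<circ> r) \<longlonglongrightarrow> l" if s: "\<And>n. s n \<in> ?A" for s :: "nat \<Rightarrow> 'a"
  proof -
    have sU: "s n \<in> U" and sb: "breg c (s n) \<le> b" for n using s by auto
    have "bounded (range (\<lambda>n. grad (s n)))"
      using grad_bound[OF s] by (auto intro!: boundedI)
    then obtain v r1 where r1: "strict_mono r1" "(\<lambda>n. grad (s (r1 n))) \<longlonglongrightarrow> v"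
      using bounded_imp_convergent_subsequence[of "\<lambda>n. grad (s n)"] by (auto simp: o_def)
    \<comment> \<open>Fenchel's equality turns the bound on the Bregman distance into one on the conjugate at the gradients.\<close>
    have conj: "z \<bullet> grad (s n) - f z \<le> b - f c + c \<bullet> grad (s n)" if "z \<in> dom" for z n
      using gradient_inequality[OF sU that, of n] sb[of n] by (simp add: breg_def inner_diff_left)
    have "v \<in> edom (fenchel_conjugate \<phi>)"
    proof (rule edom_conjugateI)
      fix z assume "z \<in> dom"
      then show "z \<bullet> v - f z \<le> b - f c + c \<bullet> v"
        by (intro LIMSEQ_le[of "\<lambda>n. z \<bullet> grad (s (r1 n)) - f z" _ "\<lambda>n. b - f c + c \<bullet> grad (s (r1 n))"]
            tendsto_intros r1(2)) (auto intro: conj)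
    qed
    then obtain d K where d: "0 < d" "\<And>z. z \<in> dom \<Longrightarrow> z \<bullet> v + d * norm z - K \<le> f z"
      using coercive by blast
    obtain N where N: "\<And>n. n \<ge> N \<Longrightarrow> norm (grad (s (r1 n)) - v) < d / 2"
      using r1(2) d(1) unfolding LIMSEQ_iff by (meson half_gt_zero)
    define G where "G = (B - f c + b) / e"
    have "norm (s (r1 (n + N))) \<le> (f c + norm c * G + K) / (d / 2)" for n
    proof -
      let ?y = "s (r1 (n + N))"
      have 1: "f ?y + (c - ?y) \<bullet> grad ?y \<le> f c"
        using gradient_inequality[OF sU U_dom[OF c]] .
      have 2: "?y \<bullet> v + d * norm ?y - K \<le> f ?y" using d(2) U_dom[OF sU] .
      have 3: "?y \<bullet> (grad ?y - v) \<le> norm ?y * (d / 2)"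
        using norm_cauchy_schwarz[of ?y "grad ?y - v"] N[of "n + N"]
          mult_left_mono[of "norm (grad ?y - v)" "d / 2" "norm ?y"] by auto
      have 4: "- (c \<bullet> grad ?y) \<le> norm c * G"
        using norm_cauchy_schwarz[of c "- grad ?y"] grad_bound[OF s, of "r1 (n + N)"]
          mult_left_mono[of "norm (grad ?y)" G "norm c"] by (auto simp: G_def)
      have "norm ?y * (d / 2) \<le> f c + norm c * G + K"
        using 1 2 3 4 by (simp add: inner_simps algebra_simps)
      then show ?thesis using d(1) by (simp add: field_simps)
    qed
    then have "bounded (range (\<lambda>n. s (r1 (n + N))))"
      by (auto intro!: boundedI)
    then obtain l r2 where r2: "strict_mono r2" "(\<lambda>n. s (r1 (r2 n + N))) \<longlonglongrightarrow> l"
      using bounded_imp_convergent_subsequence[of "\<lambda>n. s (r1 (n + N))"] by (auto simp: o_def)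
    define r where "r = (\<lambda>n. r1 (r2 n + N))"
    have r: "strict_mono r"
      using r1(1) r2(1) by (auto simp: r_def strict_mono_def)
    have "(\<lambda>n. grad (s (r n))) \<longlonglongrightarrow> v"
      unfolding r_def using LIMSEQ_subseq_LIMSEQ[OF r1(2), of "\<lambda>n. r2 n + N"] r2(1)
      by (simp add: o_def strict_mono_def)
    then have "(\<lambda>n. norm (grad (s (r n)))) \<longlonglongrightarrow> norm v" by (rule tendsto_norm)
    then have bd: "\<not> filterlim (\<lambda>n. norm (grad (s (r n)))) at_top sequentially"
      using not_tendsto_and_filterlim_at_infinity[OF sequentially_bot]
        filterlim_at_top_imp_at_infinity by blast
    have lim: "(\<lambda>n. s (r n)) \<longlonglongrightarrow> l" using r2(2) by (simp add: r_def)
    have "l \<in> U"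
    proof (rule ccontr)
      assume "l \<notin> U"
      moreover have "l \<in> closure dom"
        using lim U_dom[OF sU] unfolding closure_sequential by (intro exI[of _ "\<lambda>n. s (r n)"]) auto
      ultimately have "l \<in> frontier dom" by (simp add: frontier_def)
      then have "filterlim (\<lambda>n. norm (grad (s (r n)))) at_top sequentially"
        by (intro gradient_blows_up[OF sU _ lim])
      then show False using bd by contradiction
    qed
    moreover have "breg c l \<le> b"
      using breg_tendsto[OF c \<open>l \<in> U\<close> tendsto_const lim] sb by (intro LIMSEQ_le_const2) auto
    ultimately show ?thesis using r lim by (auto simp: o_def)
  qed
  then show ?thesis unfolding compact_def by blast
qed

lemma bregman_minimizer_exists:
  assumes y: "y \<in> U" and A: "closed A" "A \<inter> dom \<noteq> {}"
  obtains z where "z \<in> A" "z \<in> dom" "\<And>w. w \<in> A \<Longrightarrow> bregman_dist \<phi> z y \<le> bregman_dist \<phi> w y"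
proof -
  obtain a where a: "a \<in> A" "a \<in> dom" using A by auto
  let ?v = "grad y"
  obtain d K where d: "0 < d" "\<And>z. z \<in> dom \<Longrightarrow> z \<bullet> ?v + d * norm z - K \<le> f z"
    using coercive[OF grad_in_edom_conjugate[OF y]] by blast
  define m where "m = f a - a \<bullet> ?v"
  \<comment> \<open>Minimizing a continuous function over a compact piece of the epigraph, where lower semicontinuity of \<open>\<phi>\<close> is closedness.\<close>
  define E where "E = {(z, r). z \<in> A \<and> \<phi> z \<le> ereal r \<and> r - z \<bullet> ?v \<le> m}"
  have "E = (A \<times> UNIV) \<inter> ereal_epigraph \<phi> \<inter> {p. snd p - fst p \<bullet> ?v \<le> m}"
    by (auto simp: E_def ereal_epigraph_def)
  moreover have "closed {p :: 'a \<times> real. snd p - fst p \<bullet> ?v \<le> m}"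
    by (intro closed_Collect_le continuous_intros)
  ultimately have "closed E"
    using legendre A by (auto simp: legendre_def intro!: closed_Int closed_Times)
  have E: "\<phi> z \<le> ereal r \<and> z \<in> dom \<and> f z \<le> r" if "(z, r) \<in> E" for z r
    using that phi_dom[of z] domI[of z r] by (auto simp: E_def)
  define R where "R = (m + K) / d"
  have bd: "norm z \<le> R \<and> \<bar>r\<bar> \<le> \<bar>m\<bar> + \<bar>K\<bar> + R * norm ?v" if p: "(z, r) \<in> E" for z r
  proof -
    have 1: "z \<bullet> ?v + d * norm z - K \<le> r" using d(2)[of z] E[OF p] by auto
    have 2: "r - z \<bullet> ?v \<le> m" using p by (simp add: E_def)
    have "norm z * d \<le> m + K" using 1 2 by (simp add: mult.commute)
    then have nz: "norm z \<le> R" using d(1) by (simp add: R_def field_simps)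
    have 3: "\<bar>z \<bullet> ?v\<bar> \<le> R * norm ?v"
      using Cauchy_Schwarz_ineq2[of z ?v] mult_right_mono[OF nz, of "norm ?v"] by auto
    have "0 \<le> d * norm z" using d(1) by simp
    with 1 2 3 nz show ?thesis by auto
  qed
  have "bounded E"
    by (rule bounded_subset[of "cball 0 R \<times> cball 0 (\<bar>m\<bar> + \<bar>K\<bar> + R * norm ?v)"])
      (use bd in \<open>auto intro: bounded_Times simp: dist_norm\<close>)
  then have "compact E" using \<open>closed E\<close> by (simp add: compact_eq_bounded_closed)
  moreover have "(a, f a) \<in> E"
    using a phi_dom by (simp add: E_def m_def)
  then have "E \<noteq> {}" by blast
  ultimately have "\<exists>p\<in>E. \<forall>q\<in>E. snd p - fst p \<bullet> ?v \<le> snd q - fst q \<bullet> ?v"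
    by (intro continuous_attains_inf continuous_intros)
  then obtain p where "p \<in> E" and p: "\<And>q. q \<in> E \<Longrightarrow> snd p - fst p \<bullet> ?v \<le> snd q - fst q \<bullet> ?v"
    by blast
  moreover obtain z r where "p = (z, r)" by (cases p)
  ultimately have zr: "(z, r) \<in> E" and min: "\<And>w s. (w, s) \<in> E \<Longrightarrow> r - z \<bullet> ?v \<le> s - w \<bullet> ?v"
    using p[of "(_, _)"] by simp_all
  have z: "z \<in> A" "z \<in> dom" "f z \<le> r" using zr E[OF zr] by (simp_all add: E_def)
  have "f z - z \<bullet> ?v \<le> f w - w \<bullet> ?v" if "w \<in> A" "w \<in> dom" for w
  proof (cases "f w - w \<bullet> ?v \<le> m")
    case True
    then have "(w, f w) \<in> E" using that phi_dom by (simp add: E_def)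
    then show ?thesis using min[of w "f w"] z(3) by linarith
  next
    case False
    then show ?thesis using zr z(3) by (simp add: E_def)
  qed
  then have "bregman_dist \<phi> z y \<le> bregman_dist \<phi> w y" if "w \<in> A" for w
    using that y z bregman_dist_dom bregman_dist_infty[of w y]
    by (cases "w \<in> dom") (auto simp: breg_def inner_diff_left)
  then show thesis using z that by blast
qed

text \<open>On the segment to \<open>c \<in> U\<close>, the gradients blow up near an end point \<open>z\<close> on the boundary of the domain. By
  \<open>gradient_growth\<close>, the slope of \<open>\<phi>\<close> in the direction of \<open>c\<close> tends to minus infinity there, so \<open>z\<close> cannot minimize \<open>D(\<cdot>, y)\<close>.\<close>

lemma bregman_minimizer_interior:
  assumes y: "y \<in> U" and S: "convex S" and c: "c \<in> S" "c \<in> U"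
    and z: "z \<in> S" "z \<in> dom"
    and min: "\<And>w. w \<in> S \<Longrightarrow> bregman_dist \<phi> z y \<le> bregman_dist \<phi> w y"
  shows "z \<in> U"
proof (rule ccontr)
  assume "z \<notin> U"
  then have front: "z \<in> frontier dom"
    using z(2) closure_subset[of dom] by (auto simp: frontier_def)
  let ?v = "grad y"
  obtain e B where e: "0 < e" "cball c e \<subseteq> U" "\<And>z. z \<in> cball c e \<Longrightarrow> f z \<le> B"
    using bounded_above_near_interior[OF c(2)] by blast
  define t where "t n = inverse (real (Suc (Suc n)))" for n
  have t: "0 < t n" "t n < 1" for n
    by (auto simp: t_def inverse_less_1_iff)
  have "t \<longlonglongrightarrow> 0"
    unfolding t_def by (rule LIMSEQ_Suc[OF LIMSEQ_inverse_real_of_nat])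
  define s where "s n = z + t n *\<^sub>R (c - z)" for n
  have "s n = z - t n *\<^sub>R (z - c)" for n
    by (simp add: s_def algebra_simps)
  then have sU: "s n \<in> U" for n
    using mem_interior_convex_shrink[OF convex_dom c(2) z(2), of "t n"] t[of n] by simp
  have sS: "s n \<in> S" for n
    using convexD_alt[OF S z(1) c(1), of "t n"] t[of n] by (simp add: s_def algebra_simps)
  have lim: "s \<longlonglongrightarrow> z"
    unfolding s_def using tendsto_add[OF tendsto_const tendsto_scaleR[OF \<open>t \<longlonglongrightarrow> 0\<close> tendsto_const], of z "c - z"]
    by simp
  \<comment> \<open>A lower bound of \<open>f\<close> on the segment from \<open>z\<close> to \<open>c\<close>.\<close>
  define L where "L = f c - norm (z - c) * norm (grad c)"
  have "norm (grad (s n)) \<le> (B - L + norm (c - z) * norm ?v) / e" for n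
  proof -
    let ?g = "grad (s n)"
    have 1: "f (s n) + (c - s n) \<bullet> ?g + e * norm ?g \<le> B"
      using gradient_growth[OF e(2) _ e(3) sU] e(1) by simp
    have cs: "c - s n = (1 - t n) *\<^sub>R (c - z)" "z - s n = - t n *\<^sub>R (c - z)"
      by (simp_all add: s_def algebra_simps)
    have 2: "L \<le> f (s n)"
    proof -
      have "f c + (s n - c) \<bullet> grad c \<le> f (s n)"
        using gradient_inequality[OF c(2) U_dom[OF sU]] .
      moreover have "\<bar>(s n - c) \<bullet> grad c\<bar> \<le> norm (s n - c) * norm (grad c)"
        by (rule Cauchy_Schwarz_ineq2)
      moreover have "norm (s n - c) = (1 - t n) * norm (z - c)"
        unfolding norm_minus_commute[of _ c] cs(1) using t[of n] by simp
      then have "norm (s n - c) * norm (grad c) \<le> norm (z - c) * norm (grad c)"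
        using t[of n] by (intro mult_right_mono) (auto intro: mult_left_le_one_le)
      ultimately show ?thesis by (auto simp: L_def)
    qed
    \<comment> \<open>Minimality of \<open>z\<close> forbids the derivative along the segment from being very negative.\<close>
    have 3: "(c - z) \<bullet> ?v \<le> (c - z) \<bullet> ?g"
    proof -
      have "breg z y \<le> breg (s n) y"
        using min[OF sS, of n] y z(2) U_dom[OF sU, of n] by (simp add: bregman_dist_dom)
      moreover have "f (s n) + (z - s n) \<bullet> ?g \<le> f z"
        using gradient_inequality[OF sU z(2)] .
      ultimately have "(z - s n) \<bullet> ?g \<le> (z - s n) \<bullet> ?v"
        by (simp add: breg_def inner_diff_left)
      then show ?thesis using cs(2) t[of n] by simp
    qed
    have 4: "- norm (c - z) * norm ?v \<le> (1 - t n) * ((c - z) \<bullet> ?v)"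
    proof -
      have "\<bar>(1 - t n) * ((c - z) \<bullet> ?v)\<bar> \<le> 1 * (norm (c - z) * norm ?v)"
        unfolding abs_mult using t[of n] by (intro mult_mono Cauchy_Schwarz_ineq2) auto
      then show ?thesis by auto
    qed
    have "(1 - t n) * ((c - z) \<bullet> ?v) \<le> (c - s n) \<bullet> ?g"
      using 3 t[of n] by (simp add: cs(1))
    then have "e * norm ?g \<le> B - L + norm (c - z) * norm ?v"
      using 1 2 4 by linarith
    then show ?thesis using e(1) by (simp add: field_simps)
  qed
  moreover have "filterlim (\<lambda>n. norm (grad (s n))) at_top sequentially"
    by (rule gradient_blows_up[OF sU front lim])
  then obtain n where "norm (grad (s n)) > (B - L + norm (c - z) * norm ?v) / e"
    unfolding filterlim_at_top_dense by (meson eventually_sequentially order_refl)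
  ultimately show False by (meson not_less)
qed

lemma bregman_proj_unique_minimizer:
  assumes y: "y \<in> U" and S: "closed S" "convex S" "S \<inter> U \<noteq> {}"
  shows "bregman_proj \<phi> S y \<in> S" "bregman_proj \<phi> S y \<in> U"
    and "\<And>w. w \<in> S \<Longrightarrow> bregman_dist \<phi> (bregman_proj \<phi> S y) y \<le> bregman_dist \<phi> w y"
    and "\<And>w. w \<in> S \<Longrightarrow> bregman_dist \<phi> w y \<le> bregman_dist \<phi> (bregman_proj \<phi> S y) y \<Longrightarrow>
      w = bregman_proj \<phi> S y"
proof -
  obtain c where c: "c \<in> S" "c \<in> U" using S by auto
  then have "S \<inter> dom \<noteq> {}" using U_dom by blast
  then obtain z where z: "z \<in> S" "z \<in> dom" "\<And>w. w \<in> S \<Longrightarrow> bregman_dist \<phi> z y \<le> bregman_dist \<phi> w y"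
    using bregman_minimizer_exists[OF y S(1)] by blast
  note inU = bregman_minimizer_interior[OF y S(2) c]
  have zU: "z \<in> U" using inU[OF z] .
  have uniq: "w = z" if w: "w \<in> S" "bregman_dist \<phi> w y \<le> bregman_dist \<phi> z y" for w
  proof (rule ccontr)
    assume "w \<noteq> z"
    have "w \<in> dom"
      using w(2) bregman_dist_dom[OF y z(2)] bregman_dist_infty[of w y] by (cases "w \<in> dom") auto
    moreover have "\<And>u. u \<in> S \<Longrightarrow> bregman_dist \<phi> w y \<le> bregman_dist \<phi> u y"
      using w(2) z(3) order_trans by blast
    ultimately have wU: "w \<in> U" using inU[OF w(1)] by blast
    let ?m = "(1/2) *\<^sub>R (w + z)"
    have mU: "?m \<in> U"
      using convexD[OF convex_U wU zU, of "1/2" "1/2"] by (simp add: scaleR_add_right)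
    have "?m \<in> S"
      using convexD[OF S(2) w(1) z(1), of "1/2" "1/2"] by (simp add: scaleR_add_right)
    then have "breg z y \<le> breg ?m y"
      using z(3)[of ?m] y z(2) U_dom[OF mU] by (simp add: bregman_dist_dom)
    moreover have "breg w y \<le> breg z y"
      using w(2) y z(2) U_dom[OF wU] by (simp add: bregman_dist_dom)
    moreover have "breg ?m y < (breg w y + breg z y) / 2"
      using f_strict_midpoint[OF wU zU \<open>w \<noteq> z\<close>] by (simp add: breg_def inner_simps field_simps)
    ultimately show False by simp
  qed
  have "bregman_proj \<phi> S y = (THE z. is_arg_min (\<lambda>z. bregman_dist \<phi> z y) (\<lambda>z. z \<in> S) z)"
    using y S by (simp add: bregman_proj_def)
  also have "\<dots> = z"
  proof (rule the_equality)
    show "is_arg_min (\<lambda>z. bregman_dist \<phi> z y) (\<lambda>z. z \<in> S) z"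
      unfolding is_arg_min_def using z(1,3) by (meson not_less)
    show "w = z" if "is_arg_min (\<lambda>z. bregman_dist \<phi> z y) (\<lambda>z. z \<in> S) w" for w
      using that z(1) unfolding is_arg_min_def by (meson uniq not_less)
  qed
  finally have p: "bregman_proj \<phi> S y = z" .
  show "bregman_proj \<phi> S y \<in> S" "bregman_proj \<phi> S y \<in> U"
    "\<And>w. w \<in> S \<Longrightarrow> bregman_dist \<phi> (bregman_proj \<phi> S y) y \<le> bregman_dist \<phi> w y"
    "\<And>w. w \<in> S \<Longrightarrow> bregman_dist \<phi> w y \<le> bregman_dist \<phi> (bregman_proj \<phi> S y) y \<Longrightarrow>
      w = bregman_proj \<phi> S y"
    unfolding p by (fact z(1), fact zU, fact z(3), fact uniq)
qed

lemma bregman_proj_in_U: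
  assumes "y \<in> U" "closed S" "convex S" shows "bregman_proj \<phi> S y \<in> U"
proof (cases "S \<inter> U = {}")
  case True
  then show ?thesis using assms by (simp add: bregman_proj_def)
next
  case False
  then show ?thesis using bregman_proj_unique_minimizer assms by blast
qed

lemma bregman_dist_set_proj:
  assumes "y \<in> U" "closed S" "convex S" "S \<inter> U \<noteq> {}"
  shows "bregman_dist_set \<phi> S y = bregman_dist \<phi> (bregman_proj \<phi> S y) y"
  unfolding bregman_dist_set_def
  using bregman_proj_unique_minimizer[OF assms] by (intro antisym INF_lower INF_greatest) auto

text \<open>The difference of the two sides is \<open>(c - p) \<bullet> (grad p - grad y)\<close> for the projection \<open>p\<close>, which is the derivative
  of \<open>D(\<cdot>, y)\<close> at its minimizer \<open>p\<close> in the feasible direction \<open>c - p\<close>.\<close>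

lemma bregman_three_point:
  assumes y: "y \<in> U" and S: "closed S" "convex S" "S \<inter> U \<noteq> {}" and c: "c \<in> S"
  shows "bregman_dist \<phi> c (bregman_proj \<phi> S y) + bregman_dist_set \<phi> S y \<le> bregman_dist \<phi> c y"
proof (cases "c \<in> dom")
  case cdom: True
  define p where "p = bregman_proj \<phi> S y"
  note p = bregman_proj_unique_minimizer[OF y S, folded p_def]
  have "(c - p) \<bullet> grad y \<le> (c - p) \<bullet> grad p"
  proof (rule tendsto_lowerbound[OF directional_derivative[OF p(2)]])
    have "(c - p) \<bullet> grad y \<le> (f (p + t *\<^sub>R (c - p)) - f p) / t" if "0 < t" "t < 1" for t
    proof -
      let ?w = "p + t *\<^sub>R (c - p)"
      have "?w \<in> S"
        using convexD_alt[OF S(2) p(1) c, of t] that by (simp add: algebra_simps)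
      moreover have "?w \<in> dom"
        using f_convex(1)[OF U_dom[OF p(2)] cdom] that by simp
      ultimately have "breg p y \<le> breg ?w y"
        using p(3)[of ?w] y U_dom[OF p(2)] by (simp add: bregman_dist_dom)
      then show ?thesis using that by (simp add: breg_def inner_simps field_simps)
    qed
    then show "\<forall>\<^sub>F t in at_right 0. (c - p) \<bullet> grad y \<le> (f (p + t *\<^sub>R (c - p)) - f p) / t"
      by (intro eventually_at_rightI[of 0 1]) auto
  qed auto
  then have "breg c p + breg p y \<le> breg c y"
    by (simp add: breg_def inner_simps)
  then show ?thesis
    unfolding bregman_dist_set_proj[OF y S] p_def[symmetric]
    using y p(2) U_dom[OF p(2)] cdom by (simp add: bregman_dist_dom)
next
  case False
  then show ?thesis by (simp add: bregman_dist_infty)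
qed

lemma bregman_proj_measurable:
  assumes S: "measurable_set_valued N S" and x[measurable]: "x \<in> borel_measurable N"
    and Scc: "\<And>\<omega>. \<omega> \<in> space N \<Longrightarrow> closed (S \<omega>) \<and> convex (S \<omega>)"
    and xU: "\<And>\<omega>. \<omega> \<in> space N \<Longrightarrow> x \<omega> \<in> U"
  shows "(\<lambda>\<omega>. bregman_proj \<phi> (S \<omega>) (x \<omega>)) \<in> borel_measurable N"
proof (rule borel_measurableI)
  fix G :: "'a set" assume "open G"
  let ?P = "\<lambda>\<omega>. bregman_proj \<phi> (S \<omega>) (x \<omega>)"
  let ?Z = "- G"
  have Zc: "closed ?Z" using \<open>open G\<close> by (simp add: closed_Compl)
  then have Zb[measurable]: "?Z \<in> sets borel" by simp
  define E where "E = {\<omega> \<in> space N. S \<omega> \<inter> U \<noteq> {}}"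
  have E[measurable]: "E \<in> sets N"
    unfolding E_def by (rule measurable_set_valuedD[OF S]) simp
  have D[measurable]: "(\<lambda>\<omega>. bregman_dist_set \<phi> (S \<omega>) (x \<omega>)) \<in> borel_measurable N"
     "(\<lambda>\<omega>. bregman_dist_set \<phi> (S \<omega> \<inter> ?Z) (x \<omega>)) \<in> borel_measurable N"
    by (intro bregman_dist_set_measurable measurable_set_valued_Int S x Zb)+
  \<comment> \<open>By uniqueness, the projection lies in a closed set exactly when intersecting with this set does not increase the distance.\<close>
  have key: "?P \<omega> \<in> ?Z \<longleftrightarrow> bregman_dist_set \<phi> (S \<omega> \<inter> ?Z) (x \<omega>) \<le> bregman_dist_set \<phi> (S \<omega>) (x \<omega>)"
    if "\<omega> \<in> E" for \<omega>
  proof -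
    have w: "x \<omega> \<in> U" "closed (S \<omega>)" "convex (S \<omega>)" "S \<omega> \<inter> U \<noteq> {}"
      using that xU Scc by (auto simp: E_def)
    note P = bregman_proj_unique_minimizer[OF w]
    note DP = bregman_dist_set_proj[OF w]
    show ?thesis
    proof
      assume "?P \<omega> \<in> ?Z"
      then show "bregman_dist_set \<phi> (S \<omega> \<inter> ?Z) (x \<omega>) \<le> bregman_dist_set \<phi> (S \<omega>) (x \<omega>)"
        unfolding DP using P(1) unfolding bregman_dist_set_def by (intro INF_lower) auto
    next
      assume le: "bregman_dist_set \<phi> (S \<omega> \<inter> ?Z) (x \<omega>) \<le> bregman_dist_set \<phi> (S \<omega>) (x \<omega>)"
      also have "\<dots> < \<infinity>" using DP bregman_dist_dom[OF w(1) U_dom[OF P(2)]] by simp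
      finally obtain a where "a \<in> S \<omega> \<inter> ?Z" "bregman_dist \<phi> a (x \<omega>) < \<infinity>"
        unfolding bregman_dist_set_def INF_less_iff by blast
      then have "(S \<omega> \<inter> ?Z) \<inter> dom \<noteq> {}"
        using bregman_dist_infty[of a "x \<omega>"] by auto
      then obtain z where z: "z \<in> S \<omega> \<inter> ?Z" "\<And>u. u \<in> S \<omega> \<inter> ?Z \<Longrightarrow> bregman_dist \<phi> z (x \<omega>) \<le> bregman_dist \<phi> u (x \<omega>)"
        using bregman_minimizer_exists[OF w(1) closed_Int[OF w(2) Zc]] by blast
      then have "bregman_dist \<phi> z (x \<omega>) \<le> bregman_dist_set \<phi> (S \<omega> \<inter> ?Z) (x \<omega>)"
        unfolding bregman_dist_set_def by (intro INF_greatest)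
      then have "z = ?P \<omega>" using P(4)[of z] z(1) le DP by auto
      then show "?P \<omega> \<in> ?Z" using z(1) by auto
    qed
  qed
  have "?P -` G \<inter> space N =
    {\<omega> \<in> space N. (\<omega> \<in> E \<longrightarrow> \<not> bregman_dist_set \<phi> (S \<omega> \<inter> ?Z) (x \<omega>) \<le> bregman_dist_set \<phi> (S \<omega>) (x \<omega>))
       \<and> (\<omega> \<notin> E \<longrightarrow> x \<omega> \<notin> ?Z)}"
  proof (rule set_eqI)
    fix \<omega>
    show "\<omega> \<in> ?P -` G \<inter> space N \<longleftrightarrow> \<omega> \<in> {\<omega> \<in> space N. (\<omega> \<in> E \<longrightarrow> \<not> bregman_dist_set \<phi> (S \<omega> \<inter> ?Z) (x \<omega>) \<le> bregman_dist_set \<phi> (S \<omega>) (x \<omega>))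
       \<and> (\<omega> \<notin> E \<longrightarrow> x \<omega> \<notin> ?Z)}"
    proof (cases "\<omega> \<in> E")
      case True
      then show ?thesis using key[OF True] by auto
    next
      case False
      then show ?thesis by (auto simp: E_def bregman_proj_def)
    qed
  qed
  also have "\<dots> \<in> sets N" by measurable
  finally show "?P -` G \<inter> space N \<in> sets N" .
qed

end

section \<open>Random Bregman projections\<close>

lemma suminf_ennreal_finite_tendsto_0:
  fixes u :: "nat \<Rightarrow> ennreal"
  assumes "(\<Sum>n. u n) \<noteq> \<infinity>"
  shows "u \<longlonglongrightarrow> 0"
proof -
  have "u n \<noteq> top" for n
    using assms sum_le_suminf[of u "{n}"] by (auto simp: top_unique)
  then have u: "u n = ennreal (enn2real (u n))" for n by (simp add: less_top)
  then have "(\<Sum>n. ennreal (enn2real (u n))) \<noteq> top" using assms by simp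
  then have "summable (\<lambda>n. enn2real (u n))"
    by (intro summable_suminf_not_top) auto
  then have "(\<lambda>n. ennreal (enn2real (u n))) \<longlonglongrightarrow> ennreal 0"
    by (intro tendsto_ennrealI summable_LIMSEQ_zero)
  then show ?thesis using u by simp
qed

text \<open>The iterates as a function of the sequence of indices. The \<open>k\<close>-th one depends on the first \<open>k\<close> indices
  alone, which makes it independent of the next random index.\<close>

primrec random_path :: "('a::euclidean_space \<Rightarrow> ereal) \<Rightarrow> ('i \<Rightarrow> 'a set) \<Rightarrow> 'a \<Rightarrow> (nat \<Rightarrow> 'i) \<Rightarrow> nat \<Rightarrow> 'a" where
  "random_path \<phi> Cs x0 s 0 = x0"
| "random_path \<phi> Cs x0 s (Suc k) = bregman_proj \<phi> (Cs (s k)) (random_path \<phi> Cs x0 s k)"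

lemma random_path_cong:
  "(\<And>i. i < k \<Longrightarrow> s i = s' i) \<Longrightarrow> random_path \<phi> Cs x0 s k = random_path \<phi> Cs x0 s' k"
  by (induction k) auto

text \<open>The point \<open>c0\<close> is a fixed element of \<open>C \<inter> U\<close>; the distances from it to the iterates serve as the Lyapunov
  function.\<close>

locale random_bregman_projections = legendre_open_conjugate \<phi> + prob_space M
  for \<phi> :: "'a::euclidean_space \<Rightarrow> ereal" and M :: "'w measure" +
  fixes I :: "'i measure" and Cs :: "'i \<Rightarrow> 'a set" and \<xi> :: "'w \<Rightarrow> 'i"
    and \<xi>s :: "nat \<Rightarrow> 'w \<Rightarrow> 'i" and x0 c0 :: 'a and x :: "nat \<Rightarrow> 'w \<Rightarrow> 'a"
  assumes Cs: "\<And>i. i \<in> space I \<Longrightarrow> closed (Cs i) \<and> convex (Cs i)"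
    and Cs_meas: "measurable_set_valued I Cs"
    and xi [measurable]: "\<xi> \<in> measurable M I"
    and xis_indep: "indep_vars (\<lambda>_. I) \<xi>s UNIV"
    and xis_distr: "\<And>k. distr M I (\<xi>s k) = distr M I \<xi>"
    and x0: "x0 \<in> U"
    and c0: "c0 \<in> U" "c0 \<in> as_intersection M Cs \<xi>"
    and x_path: "\<And>k \<omega>. \<omega> \<in> space M \<Longrightarrow> x k \<omega> = random_path \<phi> Cs x0 (\<lambda>i. \<xi>s i \<omega>) k"
begin

abbreviation C :: "'a set" where "C \<equiv> as_intersection M Cs \<xi>"

definition index_dist :: "'i \<Rightarrow> 'a \<Rightarrow> ennreal" where
  "index_dist i y = e2ennreal (bregman_dist_set \<phi> (Cs i) y)"

lemma xis_measurable [measurable]: "\<xi>s k \<in> measurable M I"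
  using xis_indep by (auto simp: indep_vars_def)

lemma path_in_U:
  "(\<And>i. i < k \<Longrightarrow> s i \<in> space I) \<Longrightarrow> random_path \<phi> Cs x0 s k \<in> U"
  by (induction k) (use x0 Cs in \<open>auto intro!: bregman_proj_in_U\<close>)

lemma x_in_U: "\<omega> \<in> space M \<Longrightarrow> x k \<omega> \<in> U"
  using path_in_U[of k "\<lambda>i. \<xi>s i \<omega>"] measurable_space[OF xis_measurable] x_path by auto

lemma x_0: "\<omega> \<in> space M \<Longrightarrow> x 0 \<omega> = x0"
  by (simp add: x_path)

lemma x_Suc: "\<omega> \<in> space M \<Longrightarrow> x (Suc k) \<omega> = bregman_proj \<phi> (Cs (\<xi>s k \<omega>)) (x k \<omega>)"
  by (simp add: x_path)

lemma path_measurable: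
  "{..<k} \<subseteq> J \<Longrightarrow> (\<lambda>s. random_path \<phi> Cs x0 s k) \<in> borel_measurable (PiM J (\<lambda>_. I))"
proof (induction k)
  case (Suc k)
  have k: "k \<in> J" using Suc.prems by auto
  have sp: "s i \<in> space I" if "s \<in> space (PiM J (\<lambda>_. I))" "i < Suc k" for s i
    using that Suc.prems by (auto simp: space_PiM PiE_iff)
  show ?case
    unfolding random_path.simps
  proof (rule bregman_proj_measurable)
    show "measurable_set_valued (PiM J (\<lambda>_. I)) (\<lambda>s. Cs (s k))"
      using k by (intro measurable_set_valued_compose[OF Cs_meas] measurable_component_singleton)
    show "(\<lambda>s. random_path \<phi> Cs x0 s k) \<in> borel_measurable (PiM J (\<lambda>_. I))"
      using Suc.prems by (intro Suc.IH) auto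
    show "closed (Cs (s k)) \<and> convex (Cs (s k))" if "s \<in> space (PiM J (\<lambda>_. I))" for s
      using Cs sp[OF that] by blast
    show "random_path \<phi> Cs x0 s k \<in> U" if "s \<in> space (PiM J (\<lambda>_. I))" for s
      using sp[OF that] by (intro path_in_U) auto
  qed
qed simp

lemma x_eq_path_restrict:
  "\<omega> \<in> space M \<Longrightarrow> x k \<omega> = random_path \<phi> Cs x0 (\<lambda>i\<in>{..<k}. \<xi>s i \<omega>) k"
  unfolding x_path by (rule random_path_cong) simp

lemma x_measurable [measurable]: "x k \<in> borel_measurable M"
proof -
  have "(\<lambda>\<omega>. \<lambda>i\<in>{..<k}. \<xi>s i \<omega>) \<in> measurable M (PiM {..<k} (\<lambda>_. I))"
    by (intro measurable_restrict xis_measurable)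
  from measurable_compose[OF this path_measurable[OF order_refl]] show ?thesis
    by (simp add: x_eq_path_restrict cong: measurable_cong)
qed

text \<open>The index \<open>\<xi>\<^sub>k\<close> and the earlier indices are independent, and \<open>x\<^sub>k\<close> is a function of the latter. Since an index and
  an iterate have different types, independence is expressed as a product of distributions.\<close>

lemma joint_distribution:
  "distr M (I \<Otimes>\<^sub>M borel) (\<lambda>\<omega>. (\<xi>s k \<omega>, x k \<omega>)) = distr M I \<xi> \<Otimes>\<^sub>M distr M borel (x k)"
proof -
  let ?A = "PiM {k} (\<lambda>_. I)" and ?B = "PiM {..<k} (\<lambda>_. I)"
  let ?a = "\<lambda>\<omega>. \<lambda>i\<in>{k}. \<xi>s i \<omega>" and ?b = "\<lambda>\<omega>. \<lambda>i\<in>{..<k}. \<xi>s i \<omega>"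
  let ?p = "\<lambda>s. random_path \<phi> Cs x0 s k"
  have a[measurable]: "?a \<in> measurable M ?A" and b[measurable]: "?b \<in> measurable M ?B"
    by (intro measurable_restrict xis_measurable)+
  have p[measurable]: "?p \<in> borel_measurable ?B" by (rule path_measurable) simp
  have c[measurable]: "(\<lambda>s. s k) \<in> measurable ?A I" by (rule measurable_component_singleton) simp
  have "indep_var ?A ?a ?B ?b"
    by (rule indep_var_restrict[OF xis_indep]) auto
  then have ab: "distr M ?A ?a \<Otimes>\<^sub>M distr M ?B ?b = distr M (?A \<Otimes>\<^sub>M ?B) (\<lambda>\<omega>. (?a \<omega>, ?b \<omega>))"
    unfolding indep_var_distribution_eq by blast
  interpret B: prob_space "distr M ?B ?b" by (rule prob_space_distr) (rule b)
  have xb: "distr (distr M ?B ?b) borel ?p = distr M borel (x k)"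
    by (subst distr_distr[OF p b]) (auto simp: x_eq_path_restrict intro!: distr_cong)
  interpret X: prob_space "distr (distr M ?B ?b) borel ?p"
    unfolding xb by (rule prob_space_distr) (rule x_measurable)
  have "distr M I \<xi> \<Otimes>\<^sub>M distr M borel (x k)
      = distr (distr M ?A ?a) I (\<lambda>s. s k) \<Otimes>\<^sub>M distr (distr M ?B ?b) borel ?p"
    unfolding xb xis_distr[of k, symmetric] by (subst distr_distr[OF c a]) (simp add: o_def)
  also have "\<dots> = distr (distr M ?A ?a \<Otimes>\<^sub>M distr M ?B ?b) (I \<Otimes>\<^sub>M borel) (\<lambda>(s, t). (s k, ?p t))"
    by (rule pair_measure_distr) (measurable, unfold_locales)
  also have "\<dots> = distr M (I \<Otimes>\<^sub>M borel) ((\<lambda>(s, t). (s k, ?p t)) \<circ> (\<lambda>\<omega>. (?a \<omega>, ?b \<omega>)))"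
    unfolding ab by (rule distr_distr) measurable
  also have "\<dots> = distr M (I \<Otimes>\<^sub>M borel) (\<lambda>\<omega>. (\<xi>s k \<omega>, x k \<omega>))"
    by (intro distr_cong) (auto simp: x_eq_path_restrict)
  finally show ?thesis by simp
qed

lemma index_dist_measurable [measurable]: "case_prod index_dist \<in> borel_measurable (I \<Otimes>\<^sub>M borel)"
proof -
  have "(\<lambda>p. bregman_dist_set \<phi> (Cs (fst p)) (snd p)) \<in> borel_measurable (I \<Otimes>\<^sub>M borel)"
    by (intro bregman_dist_set_measurable measurable_set_valued_compose[OF Cs_meas]) auto
  then show ?thesis
    unfolding index_dist_def case_prod_beta by measurable
qed

lemma mean_eq: "mean_bregman_dist \<phi> M Cs \<xi> y = (\<integral>\<^sup>+ i. index_dist i y \<partial>distr M I \<xi>)"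
  by (simp add: nn_integral_distr mean_bregman_dist_def index_dist_def[symmetric])

lemma mean_measurable [measurable]: "mean_bregman_dist \<phi> M Cs \<xi> \<in> borel_measurable borel"
proof -
  interpret D: prob_space "distr M I \<xi>" by (rule prob_space_distr) simp
  show ?thesis
    unfolding mean_eq by measurable
qed

text \<open>Fubini's theorem for the product distribution: averaging over the next index with the current iterate held
  fixed does not change the expectation.\<close>

lemma expectation_mean:
  "(\<integral>\<^sup>+ \<omega>. mean_bregman_dist \<phi> M Cs \<xi> (x k \<omega>) \<partial>M) = (\<integral>\<^sup>+ \<omega>. index_dist (\<xi>s k \<omega>) (x k \<omega>) \<partial>M)"
proof -
  interpret D: prob_space "distr M I \<xi>" by (rule prob_space_distr) simp
  interpret X: prob_space "distr M borel (x k)" by (rule prob_space_distr) simp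
  interpret P: pair_prob_space "distr M I \<xi>" "distr M borel (x k)" ..
  have "(\<integral>\<^sup>+ \<omega>. mean_bregman_dist \<phi> M Cs \<xi> (x k \<omega>) \<partial>M)
      = (\<integral>\<^sup>+ y. \<integral>\<^sup>+ i. index_dist i y \<partial>distr M I \<xi> \<partial>distr M borel (x k))"
    unfolding mean_eq[symmetric] by (simp add: nn_integral_distr)
  also have "\<dots> = (\<integral>\<^sup>+ p. case_prod index_dist p \<partial>(distr M I \<xi> \<Otimes>\<^sub>M distr M borel (x k)))"
    using P.nn_integral_snd[of "case_prod index_dist"] by simp
  also have "\<dots> = (\<integral>\<^sup>+ \<omega>. index_dist (\<xi>s k \<omega>) (x k \<omega>) \<partial>M)"
    unfolding joint_distribution[symmetric] by (simp add: nn_integral_distr)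
  finally show ?thesis .
qed

text \<open>Each single point of \<open>C\<close> lies in almost every set of the family. A countable dense subset gives this
  simultaneously, and closedness of the sets extends it to all of \<open>C\<close>.\<close>

lemma AE_C_subset: "AE i in distr M I \<xi>. C \<subseteq> Cs i"
proof -
  obtain T where T: "countable T" "T \<subseteq> C" "C \<subseteq> closure T"
    using separable by blast
  have "AE i in distr M I \<xi>. t \<in> Cs i" if "t \<in> T" for t
  proof -
    have "{i \<in> space I. t \<in> Cs i} \<in> sets I"
      using measurable_set_valuedD[OF Cs_meas, of "{t}"] by simp
    moreover have "AE \<omega> in M. t \<in> Cs (\<xi> \<omega>)"
      using T(2) that by (auto simp: as_intersection_def)
    ultimately show ?thesis by (simp add: AE_distr_iff[OF xi])
  qed
  then have "AE i in distr M I \<xi>. \<forall>t\<in>T. t \<in> Cs i"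
    using T(1) by (simp add: AE_ball_countable)
  with AE_space show ?thesis
  proof eventually_elim
    case (elim i)
    then have "closure T \<subseteq> Cs i" using Cs by (intro closure_minimal) auto
    then show ?case using T(3) by blast
  qed
qed

lemma AE_C_subset_xi: "AE \<omega> in M. C \<subseteq> Cs (\<xi> \<omega>)"
  by (rule AE_distrD[OF xi AE_C_subset])

lemma AE_C_subset_xis: "AE \<omega> in M. \<forall>k. C \<subseteq> Cs (\<xi>s k \<omega>)"
  unfolding AE_all_countable
proof
  fix k
  show "AE \<omega> in M. C \<subseteq> Cs (\<xi>s k \<omega>)"
    using AE_C_subset unfolding xis_distr[of k, symmetric] by (rule AE_distrD[OF xis_measurable])
qed

lemma mean_finite:
  assumes y: "y \<in> U" shows "mean_bregman_dist \<phi> M Cs \<xi> y < \<infinity>"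
proof -
  have "mean_bregman_dist \<phi> M Cs \<xi> y \<le> (\<integral>\<^sup>+ \<omega>. ennreal (breg c0 y) \<partial>M)"
    unfolding mean_bregman_dist_def
  proof (rule nn_integral_mono_AE)
    show "AE \<omega> in M. e2ennreal (bregman_dist_set \<phi> (Cs (\<xi> \<omega>)) y) \<le> ennreal (breg c0 y)"
      using AE_C_subset_xi
    proof eventually_elim
      case (elim \<omega>)
      then have "bregman_dist_set \<phi> (Cs (\<xi> \<omega>)) y \<le> ereal (breg c0 y)"
        using c0 unfolding bregman_dist_dom[OF y U_dom[OF c0(1)], symmetric] bregman_dist_set_def
        by (intro INF_lower) auto
      then show ?case using e2ennreal_mono by fastforce
    qed
  qed
  also have "\<dots> < \<infinity>" by (simp add: emeasure_space_1)
  finally show ?thesis .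
qed

lemma AE_descent:
  "AE \<omega> in M. \<forall>k. \<forall>c\<in>C. bregman_dist \<phi> c (x (Suc k) \<omega>) + bregman_dist_set \<phi> (Cs (\<xi>s k \<omega>)) (x k \<omega>)
     \<le> bregman_dist \<phi> c (x k \<omega>)"
  using AE_C_subset_xis AE_space
proof eventually_elim
  case (elim \<omega>)
  show ?case
  proof (intro allI ballI)
    fix k c assume "c \<in> C"
    have "\<xi>s k \<omega> \<in> space I" using elim(2) measurable_space[OF xis_measurable] by blast
    moreover have "c0 \<in> Cs (\<xi>s k \<omega>) \<inter> U" "c \<in> Cs (\<xi>s k \<omega>)"
      using elim(1) c0 \<open>c \<in> C\<close> by auto
    ultimately show "bregman_dist \<phi> c (x (Suc k) \<omega>) + bregman_dist_set \<phi> (Cs (\<xi>s k \<omega>)) (x k \<omega>)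
      \<le> bregman_dist \<phi> c (x k \<omega>)"
      unfolding x_Suc[OF elim(2)] using Cs x_in_U[OF elim(2)]
      by (intro bregman_three_point) auto
  qed
qed

lemma AE_fejer: "AE \<omega> in M. bregman_fejer \<phi> C (\<lambda>k. x k \<omega>)"
  using AE_descent AE_space
proof eventually_elim
  case (elim \<omega>)
  have "bregman_dist \<phi> c (x (Suc k) \<omega>) \<le> bregman_dist \<phi> c (x k \<omega>)" if "c \<in> C" for c k
  proof -
    have "bregman_dist \<phi> c (x (Suc k) \<omega>) + 0
       \<le> bregman_dist \<phi> c (x (Suc k) \<omega>) + bregman_dist_set \<phi> (Cs (\<xi>s k \<omega>)) (x k \<omega>)"
      by (intro add_left_mono bregman_dist_set_nonneg)
    also have "\<dots> \<le> bregman_dist \<phi> c (x k \<omega>)" using elim that by blast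
    finally show ?thesis by simp
  qed
  then show ?case using x_in_U[OF elim(2)] by (simp add: bregman_fejer_def)
qed

lemma fejer_decseq:
  assumes "bregman_fejer \<phi> S s" "c \<in> S" "c \<in> dom"
  shows "decseq (\<lambda>k. breg c (s k))"
  using assms bregman_dist_dom[of _ c] by (intro decseq_SucI) (auto simp: bregman_fejer_def)

definition start_sublevel where "start_sublevel = {y \<in> U. breg c0 y \<le> breg c0 x0}"

lemma start_sublevel: "compact start_sublevel" "start_sublevel \<subseteq> U"
  unfolding start_sublevel_def using bregman_sublevel_compact[OF c0(1)] by auto

lemma fejer_bound:
  assumes "\<omega> \<in> space M" "bregman_fejer \<phi> C (\<lambda>k. x k \<omega>)"
  shows "breg c0 (x k \<omega>) \<le> breg c0 x0" "x k \<omega> \<in> start_sublevel"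
proof -
  have "decseq (\<lambda>k. breg c0 (x k \<omega>))"
    by (rule fejer_decseq[OF assms(2) c0(2) U_dom[OF c0(1)]])
  from decseqD[OF this, of 0 k] show "breg c0 (x k \<omega>) \<le> breg c0 x0"
    using x_0[OF assms(1)] by simp
  then show "x k \<omega> \<in> start_sublevel" using x_in_U[OF assms(1)] by (simp add: start_sublevel_def)
qed

text \<open>The three-point inequality with \<open>c = c0\<close> telescopes.\<close>

lemma AE_sum_bound:
  "AE \<omega> in M. \<forall>n. (\<Sum>k<n. index_dist (\<xi>s k \<omega>) (x k \<omega>)) \<le> ennreal (breg c0 x0)"
  using AE_descent AE_space
proof eventually_elim
  case (elim \<omega>)
  have step: "ennreal (breg c0 (x (Suc k) \<omega>)) + index_dist (\<xi>s k \<omega>) (x k \<omega>) \<le> ennreal (breg c0 (x k \<omega>))" for k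
  proof -
    let ?D = "bregman_dist_set \<phi> (Cs (\<xi>s k \<omega>)) (x k \<omega>)"
    note U = x_in_U[OF elim(2)]
    have "ereal (breg c0 (x (Suc k) \<omega>)) + ?D \<le> ereal (breg c0 (x k \<omega>))"
      using elim(1) c0(2) by (simp add: bregman_dist_dom[OF U U_dom[OF c0(1)], symmetric])
    moreover have "0 \<le> ?D" by (rule bregman_dist_set_nonneg)
    ultimately show ?thesis
      using breg_nonneg[OF U U_dom[OF c0(1)]] unfolding index_dist_def
      by (cases ?D) (auto simp: ennreal_plus[symmetric] simp del: ennreal_plus intro!: ennreal_leI)
  qed
  have "ennreal (breg c0 (x n \<omega>)) + (\<Sum>k<n. index_dist (\<xi>s k \<omega>) (x k \<omega>)) \<le> ennreal (breg c0 x0)" for n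
  proof (induction n)
    case (Suc n)
    have "ennreal (breg c0 (x (Suc n) \<omega>)) + (\<Sum>k<Suc n. index_dist (\<xi>s k \<omega>) (x k \<omega>))
      = (ennreal (breg c0 (x (Suc n) \<omega>)) + index_dist (\<xi>s n \<omega>) (x n \<omega>)) + (\<Sum>k<n. index_dist (\<xi>s k \<omega>) (x k \<omega>))"
      by (simp add: ac_simps)
    also have "\<dots> \<le> ennreal (breg c0 (x n \<omega>)) + (\<Sum>k<n. index_dist (\<xi>s k \<omega>) (x k \<omega>))"
      by (intro add_right_mono step)
    finally show ?case using Suc by (rule order_trans)
  qed (simp add: x_0[OF elim(2)])
  moreover have "(\<Sum>k<n. index_dist (\<xi>s k \<omega>) (x k \<omega>))
      \<le> ennreal (breg c0 (x n \<omega>)) + (\<Sum>k<n. index_dist (\<xi>s k \<omega>) (x k \<omega>))" for n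
    by simp
  ultimately show ?case using order_trans by blast
qed

lemma AE_mean_tendsto: "AE \<omega> in M. (\<lambda>k. mean_bregman_dist \<phi> M Cs \<xi> (x k \<omega>)) \<longlonglongrightarrow> 0"
proof -
  let ?m = "\<lambda>k \<omega>. mean_bregman_dist \<phi> M Cs \<xi> (x k \<omega>)"
  have hm: "(\<lambda>\<omega>. index_dist (\<xi>s k \<omega>) (x k \<omega>)) \<in> borel_measurable M" for k
    using measurable_compose[OF measurable_Pair[OF xis_measurable x_measurable] index_dist_measurable] by simp
  have "(\<integral>\<^sup>+ \<omega>. (\<Sum>k. ?m k \<omega>) \<partial>M) = (\<Sum>k. \<integral>\<^sup>+ \<omega>. ?m k \<omega> \<partial>M)"
    by (rule nn_integral_suminf) simp
  also have "\<dots> \<le> ennreal (breg c0 x0)"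
  proof (rule suminf_le_const)
    fix n
    have "(\<Sum>k<n. \<integral>\<^sup>+ \<omega>. ?m k \<omega> \<partial>M) = (\<integral>\<^sup>+ \<omega>. (\<Sum>k<n. index_dist (\<xi>s k \<omega>) (x k \<omega>)) \<partial>M)"
      unfolding expectation_mean using hm by (simp add: nn_integral_sum)
    also have "\<dots> \<le> (\<integral>\<^sup>+ \<omega>. ennreal (breg c0 x0) \<partial>M)"
      using AE_sum_bound by (intro nn_integral_mono_AE) (auto elim: eventually_mono)
    finally show "(\<Sum>k<n. \<integral>\<^sup>+ \<omega>. ?m k \<omega> \<partial>M) \<le> ennreal (breg c0 x0)"
      by (simp add: emeasure_space_1)
  qed simp
  finally have "(\<integral>\<^sup>+ \<omega>. (\<Sum>k. ?m k \<omega>) \<partial>M) \<noteq> \<infinity>"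
    using ennreal_less_top[of "breg c0 x0"] by (auto simp: top_unique)
  then have "AE \<omega> in M. (\<Sum>k. ?m k \<omega>) \<noteq> \<infinity>"
    by (intro nn_integral_PInf_AE) auto
  then show ?thesis
    by (rule eventually_mono) (rule suminf_ennreal_finite_tendsto_0)
qed

text \<open>By Fatou's lemma, the lower limit of the distances from \<open>w j\<close> to almost every set of the family vanishes, so
  these distances are not bounded away from zero and \<open>y\<close> belongs to the set.\<close>

lemma mean_zero_limit_in_C:
  assumes y: "y \<in> U" and w: "w \<longlonglongrightarrow> y" and m: "(\<lambda>j. mean_bregman_dist \<phi> M Cs \<xi> (w j)) \<longlonglongrightarrow> 0"
  shows "y \<in> C"
proof -
  have hm[measurable]: "(\<lambda>\<omega>. index_dist (\<xi> \<omega>) (w j)) \<in> borel_measurable M" for j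
    using measurable_compose[OF measurable_Pair[OF xi measurable_const] index_dist_measurable, of "w j"] by simp
  have "(\<integral>\<^sup>+ \<omega>. liminf (\<lambda>j. index_dist (\<xi> \<omega>) (w j)) \<partial>M) \<le> liminf (\<lambda>j. \<integral>\<^sup>+ \<omega>. index_dist (\<xi> \<omega>) (w j) \<partial>M)"
    by (rule nn_integral_liminf) measurable
  also have "\<dots> = 0"
    using lim_imp_Liminf[OF sequentially_bot m] by (simp add: mean_bregman_dist_def index_dist_def)
  finally have "AE \<omega> in M. liminf (\<lambda>j. index_dist (\<xi> \<omega>) (w j)) = 0"
    by (subst (asm) le_zero_eq, subst (asm) nn_integral_0_iff_AE) measurable
  then have "AE \<omega> in M. y \<in> Cs (\<xi> \<omega>)"
    using AE_space
  proof eventually_elim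
    case (elim \<omega>)
    show ?case
    proof (rule ccontr)
      assume "y \<notin> Cs (\<xi> \<omega>)"
      moreover have "closed (Cs (\<xi> \<omega>))"
        using Cs measurable_space[OF xi elim(2)] by blast
      ultimately obtain r e where re: "0 < r" "0 < e"
        "\<And>u. u \<in> ball y r \<Longrightarrow> ereal e \<le> bregman_dist_set \<phi> (Cs (\<xi> \<omega>)) u"
        using bregman_dist_set_bounded_away[OF y] by blast
      have "\<forall>\<^sub>F j in sequentially. dist (w j) y < r"
        using w re(1) by (rule tendstoD)
      then have "\<forall>\<^sub>F j in sequentially. ennreal e \<le> index_dist (\<xi> \<omega>) (w j)"
      proof eventually_elim
        case (elim j)
        then have "e2ennreal (ereal e) \<le> index_dist (\<xi> \<omega>) (w j)"
          unfolding index_dist_def by (intro e2ennreal_mono re(3)) (simp add: dist_commute)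
        then show ?case by simp
      qed
      then have "ennreal e \<le> liminf (\<lambda>j. index_dist (\<xi> \<omega>) (w j))"
        by (rule Liminf_bounded)
      then show False using elim(1) re(2) by simp
    qed
  qed
  then show ?thesis by (simp add: as_intersection_def)
qed

text \<open>Let \<open>y\<close> be a cluster point. It belongs to \<open>C\<close>, so the distances from \<open>y\<close> to the iterates decrease; their limit is
  zero because it is zero along a subsequence.\<close>

lemma fejer_converges:
  assumes \<omega>: "\<omega> \<in> space M" and fejer: "bregman_fejer \<phi> C (\<lambda>k. x k \<omega>)"
    and m: "(\<lambda>k. mean_bregman_dist \<phi> M Cs \<xi> (x k \<omega>)) \<longlonglongrightarrow> 0"
  obtains y where "y \<in> C" "y \<in> U" "(\<lambda>k. x k \<omega>) \<longlonglongrightarrow> y"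
proof -
  obtain y r where y: "y \<in> start_sublevel" and r: "strict_mono r" "((\<lambda>k. x k \<omega>) \<circ> r) \<longlonglongrightarrow> y"
    using start_sublevel(1) fejer_bound(2)[OF \<omega> fejer] unfolding compact_def by metis
  have yU: "y \<in> U" using y start_sublevel by blast
  have lim: "(\<lambda>j. x (r j) \<omega>) \<longlonglongrightarrow> y" using r(2) by (simp add: o_def)
  have yC: "y \<in> C"
    using mean_zero_limit_in_C[OF yU lim] LIMSEQ_subseq_LIMSEQ[OF m r(1)] by (simp add: o_def)
  have dec: "decseq (\<lambda>k. breg y (x k \<omega>))"
    by (rule fejer_decseq[OF fejer yC U_dom[OF yU]])
  moreover have "0 \<le> breg y (x k \<omega>)" for k
    using breg_nonneg[OF x_in_U[OF \<omega>] U_dom[OF yU]] .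
  ultimately obtain L where L: "(\<lambda>k. breg y (x k \<omega>)) \<longlonglongrightarrow> L"
    using decseq_convergent by blast
  have "(\<lambda>j. breg y (x (r j) \<omega>)) \<longlonglongrightarrow> L"
    using LIMSEQ_subseq_LIMSEQ[OF L r(1)] by (simp add: o_def)
  moreover have "(\<lambda>j. breg y (x (r j) \<omega>)) \<longlonglongrightarrow> breg y y"
    by (rule breg_tendsto[OF yU yU tendsto_const lim])
  ultimately have "L = 0" using LIMSEQ_unique by fastforce
  then have "(\<lambda>k. x k \<omega>) \<longlonglongrightarrow> y"
    using L by (intro breg_tendsto_zero_imp_tendsto[OF start_sublevel yU fejer_bound(2)[OF \<omega> fejer]]) simp
  then show thesis using that yC yU by blast
qed

definition xhat where "xhat \<omega> = lim (\<lambda>k. x k \<omega>)"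

lemma xhat_measurable [measurable]: "xhat \<in> borel_measurable M"
  unfolding xhat_def[abs_def] by measurable

lemma AE_converges: "AE \<omega> in M. xhat \<omega> \<in> C \<inter> U \<and> (\<lambda>k. x k \<omega>) \<longlonglongrightarrow> xhat \<omega>"
  using AE_fejer AE_mean_tendsto AE_space
proof eventually_elim
  case (elim \<omega>)
  then obtain y where "y \<in> C" "y \<in> U" "(\<lambda>k. x k \<omega>) \<longlonglongrightarrow> y"
    using fejer_converges by metis
  then show ?case using limI by (auto simp: xhat_def)
qed

lemma AE_decseq_dist: "AE \<omega> in M. decseq (\<lambda>k. bregman_dist_set \<phi> C (x k \<omega>))"
  using AE_fejer
proof eventually_elim
  case (elim \<omega>)
  then show ?case
    unfolding bregman_dist_set_def bregman_fejer_def
    by (intro decseq_SucI INF_mono) blast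
qed

text \<open>The distance to \<open>C\<close> is at most the distance from the limit, which itself belongs to \<open>C\<close>.\<close>

lemma AE_dist_tendsto: "AE \<omega> in M. (\<lambda>k. bregman_dist_set \<phi> C (x k \<omega>)) \<longlonglongrightarrow> 0"
  using AE_converges AE_space
proof eventually_elim
  case (elim \<omega>)
  then have y: "xhat \<omega> \<in> C" "xhat \<omega> \<in> U" and lim: "(\<lambda>k. x k \<omega>) \<longlonglongrightarrow> xhat \<omega>" by auto
  have "(\<lambda>k. breg (xhat \<omega>) (x k \<omega>)) \<longlonglongrightarrow> 0"
    using breg_tendsto[OF y(2) y(2) tendsto_const lim] by simp
  then have "(\<lambda>k. ereal (breg (xhat \<omega>) (x k \<omega>))) \<longlonglongrightarrow> 0"
    by (simp add: zero_ereal_def)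
  moreover have "bregman_dist_set \<phi> C (x k \<omega>) \<le> ereal (breg (xhat \<omega>) (x k \<omega>))" for k
    unfolding bregman_dist_set_def
      bregman_dist_dom[OF x_in_U[OF elim(2)] U_dom[OF y(2)], symmetric]
    by (intro INF_lower y)
  ultimately show ?case
    using tendsto_sandwich[where f = "\<lambda>_. 0" and g = "\<lambda>k. bregman_dist_set \<phi> C (x k \<omega>)"
        and h = "\<lambda>k. ereal (breg (xhat \<omega>) (x k \<omega>))" and net = sequentially]
    by (simp add: bregman_dist_set_nonneg)
qed

lemma expectation_dist_tendsto:
  "(\<lambda>k. \<integral>\<^sup>+ \<omega>. e2ennreal (bregman_dist_set \<phi> C (x k \<omega>)) \<partial>M) \<longlonglongrightarrow> 0"
proof -
  have [measurable]: "(\<lambda>\<omega>. bregman_dist_set \<phi> C (x k \<omega>)) \<in> borel_measurable M" for k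
    by (intro bregman_dist_set_measurable measurable_set_valued_const) simp
  have "(\<lambda>k. \<integral>\<^sup>+ \<omega>. e2ennreal (bregman_dist_set \<phi> C (x k \<omega>)) \<partial>M) \<longlonglongrightarrow> (\<integral>\<^sup>+ \<omega>. 0 \<partial>M)"
  proof (rule nn_integral_dominated_convergence[where w = "\<lambda>_. ennreal (breg c0 x0)"])
    show "AE \<omega> in M. e2ennreal (bregman_dist_set \<phi> C (x k \<omega>)) \<le> ennreal (breg c0 x0)" for k
      using AE_fejer AE_space
    proof eventually_elim
      case (elim \<omega>)
      have "bregman_dist_set \<phi> C (x k \<omega>) \<le> bregman_dist \<phi> c0 (x k \<omega>)"
        unfolding bregman_dist_set_def by (intro INF_lower c0)
      also have "\<dots> \<le> ereal (breg c0 x0)"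
        using fejer_bound(1)[OF elim(2,1)] bregman_dist_dom[OF x_in_U[OF elim(2)] U_dom[OF c0(1)]] by simp
      finally show ?case using e2ennreal_mono by fastforce
    qed
    show "AE \<omega> in M. (\<lambda>k. e2ennreal (bregman_dist_set \<phi> C (x k \<omega>))) \<longlonglongrightarrow> 0"
      using AE_dist_tendsto
    proof eventually_elim
      case (elim \<omega>)
      then have "(\<lambda>k. e2ennreal (bregman_dist_set \<phi> C (x k \<omega>))) \<longlonglongrightarrow> e2ennreal 0"
        by (intro tendsto_e2ennrealI)
      then show ?case by (simp add: e2ennreal_neg)
    qed
    show "(\<integral>\<^sup>+ \<omega>. ennreal (breg c0 x0) \<partial>M) < \<infinity>" by (simp add: emeasure_space_1)
  qed simp_all
  then show ?thesis by simp
qed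

lemma converges_in_distribution_xhat: "converges_in_distribution M x xhat"
  unfolding converges_in_distribution_def
proof (intro conjI allI impI)
  fix g :: "'a \<Rightarrow> real" assume g: "continuous_on UNIV g \<and> bounded (range g)"
  then obtain B where B: "\<And>u. norm (g u) \<le> B" unfolding bounded_iff by blast
  have [measurable]: "g \<in> borel_measurable borel"
    using g by (intro borel_measurable_continuous_onI) simp
  show "(\<lambda>k. \<integral>\<omega>. g (x k \<omega>) \<partial>M) \<longlonglongrightarrow> (\<integral>\<omega>. g (xhat \<omega>) \<partial>M)"
  proof (rule integral_dominated_convergence[where w = "\<lambda>_. B"])
    show "AE \<omega> in M. (\<lambda>k. g (x k \<omega>)) \<longlonglongrightarrow> g (xhat \<omega>)"
      using AE_converges
    proof eventually_elim
      case (elim \<omega>)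
      then show ?case
        using g isCont_tendsto_compose[of "xhat \<omega>" g]
        unfolding continuous_on_eq_continuous_at[OF open_UNIV] by blast
    qed
  qed (use B in auto)
qed simp_all

lemma square_mean_convergence:
  "(\<lambda>k. \<integral>\<^sup>+ \<omega>. ennreal ((norm (x k \<omega> - xhat \<omega>))\<^sup>2) \<partial>M) \<longlonglongrightarrow> 0"
proof -
  obtain B where B: "\<And>y. y \<in> start_sublevel \<Longrightarrow> norm y \<le> B"
    using compact_imp_bounded[OF start_sublevel(1)] unfolding bounded_iff by blast
  have "(\<lambda>k. \<integral>\<^sup>+ \<omega>. ennreal ((norm (x k \<omega> - xhat \<omega>))\<^sup>2) \<partial>M) \<longlonglongrightarrow> (\<integral>\<^sup>+ \<omega>. 0 \<partial>M)"
  proof (rule nn_integral_dominated_convergence[where w = "\<lambda>_. ennreal ((B + B)\<^sup>2)"])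
    show "AE \<omega> in M. ennreal ((norm (x k \<omega> - xhat \<omega>))\<^sup>2) \<le> ennreal ((B + B)\<^sup>2)" for k
      using AE_fejer AE_converges AE_space
    proof eventually_elim
      case (elim \<omega>)
      note xK = fejer_bound(2)[OF elim(3,1)]
      have "xhat \<omega> \<in> start_sublevel"
        using closed_sequentially[OF compact_imp_closed[OF start_sublevel(1)], of "\<lambda>k. x k \<omega>"] elim(2) xK by blast
      then have "norm (x k \<omega> - xhat \<omega>) \<le> B + B"
        using B[OF xK[of k]] B[of "xhat \<omega>"] norm_triangle_ineq4[of "x k \<omega>" "xhat \<omega>"] by linarith
      then show ?case by (intro ennreal_leI power_mono) auto
    qed
    show "AE \<omega> in M. (\<lambda>k. ennreal ((norm (x k \<omega> - xhat \<omega>))\<^sup>2)) \<longlonglongrightarrow> 0"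
      using AE_converges
    proof eventually_elim
      case (elim \<omega>)
      then have "(\<lambda>k. norm (x k \<omega> - xhat \<omega>)) \<longlonglongrightarrow> 0"
        by (simp add: LIM_zero tendsto_norm_zero)
      then have "(\<lambda>k. ennreal ((norm (x k \<omega> - xhat \<omega>))\<^sup>2)) \<longlonglongrightarrow> ennreal (0\<^sup>2)"
        by (intro tendsto_ennrealI tendsto_power)
      then show ?case by simp
    qed
    show "(\<integral>\<^sup>+ \<omega>. ennreal ((B + B)\<^sup>2) \<partial>M) < \<infinity>" by (simp add: emeasure_space_1)
  qed simp_all
  then show ?thesis by simp
qed

end

section \<open>The convergence theorem\<close>

theorem theorem3p7:
  fixes \<phi> :: "'a::euclidean_space \<Rightarrow> ereal"
    and I :: "'i measure" and Cs :: "'i \<Rightarrow> 'a set"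
    and M :: "'w measure" and \<xi> :: "'w \<Rightarrow> 'i" and \<xi>s :: "nat \<Rightarrow> 'w \<Rightarrow> 'i"
    and C U :: "'a set" and x0 :: 'a and x :: "nat \<Rightarrow> 'w \<Rightarrow> 'a"
  assumes prob: "prob_space M"
    and Cs: "\<And>i. i \<in> space I \<Longrightarrow> Cs i \<noteq> {} \<and> closed (Cs i) \<and> convex (Cs i)"
    and Cs_meas: "measurable_set_valued I Cs"
    and xi: "\<xi> \<in> measurable M I"
    and C_def: "C = as_intersection M Cs \<xi>"
    and C_ne: "C \<noteq> {}" and C_proper: "C \<noteq> UNIV"
    and legendre: "legendre \<phi>"
    and U_def: "U = interior (edom \<phi>)"
    and conj_open: "open (edom (fenchel_conjugate \<phi>))"
    and U_C: "U \<inter> C \<noteq> {}"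
    and xis_indep: "prob_space.indep_vars M (\<lambda>_. I) \<xi>s UNIV"
    and xis_distr: "\<And>k. distr M I (\<xi>s k) = distr M I \<xi>"
    and x0: "x0 \<in> U"
    and x_0: "\<And>\<omega>. \<omega> \<in> space M \<Longrightarrow> x 0 \<omega> = x0"
    and x_Suc: "\<And>k \<omega>. \<omega> \<in> space M \<Longrightarrow> x (Suc k) \<omega> = bregman_proj \<phi> (Cs (\<xi>s k \<omega>)) (x k \<omega>)"
  shows
    "((\<forall>k. x k \<in> borel_measurable M) \<and> (\<forall>y\<in>U. mean_bregman_dist \<phi> M Cs \<xi> y < \<infinity>)) \<and>
     ((AE \<omega> in M. bregman_fejer \<phi> C (\<lambda>k. x k \<omega>)) \<and>
      (\<exists>K. compact K \<and> (AE \<omega> in M. \<forall>k. x k \<omega> \<in> K))) \<and>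
     ((AE \<omega> in M. decseq (\<lambda>k. bregman_dist_set \<phi> C (x k \<omega>))) \<and>
      (AE \<omega> in M. (\<lambda>k. mean_bregman_dist \<phi> M Cs \<xi> (x k \<omega>)) \<longlonglongrightarrow> 0)) \<and>
     (\<exists>xhat \<in> borel_measurable M. \<exists>n. strict_mono n \<and>
        (AE \<omega> in M. xhat \<omega> \<in> C \<inter> U) \<and>
        converges_in_distribution M (\<lambda>k. x (n k)) xhat) \<and>
     ((AE \<omega> in M. (\<lambda>k. bregman_dist_set \<phi> C (x k \<omega>)) \<longlonglongrightarrow> 0) \<and>
      (\<lambda>k. \<integral>\<^sup>+ \<omega>. e2ennreal (bregman_dist_set \<phi> C (x k \<omega>)) \<partial>M) \<longlonglongrightarrow> 0) \<and>
     ((\<forall>z y. (\<forall>k. z k \<in> U \<and> y k \<in> U) \<and> bounded (range z) \<and> bounded (range y) \<and>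
             (\<lambda>k. bregman_dist \<phi> (z k) (y k)) \<longlonglongrightarrow> 0 \<longrightarrow> (\<lambda>k. z k - y k) \<longlonglongrightarrow> 0) \<longrightarrow>
      (\<exists>xhat \<in> borel_measurable M.
         (AE \<omega> in M. xhat \<omega> \<in> U \<inter> C) \<and>
         (AE \<omega> in M. (\<lambda>k. x k \<omega>) \<longlonglongrightarrow> xhat \<omega>) \<and>
         (\<lambda>k. \<integral>\<^sup>+ \<omega>. ennreal ((norm (x k \<omega> - xhat \<omega>))\<^sup>2) \<partial>M) \<longlonglongrightarrow> 0))"
proof -
  interpret M: prob_space M by (rule prob)
  interpret L: legendre_open_conjugate \<phi>
    by unfold_locales (fact legendre, fact conj_open)
  obtain c0 where c0: "c0 \<in> U" "c0 \<in> C" using U_C by blast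
  have path: "x k \<omega> = random_path \<phi> Cs x0 (\<lambda>i. \<xi>s i \<omega>) k" if "\<omega> \<in> space M" for k \<omega>
    by (induction k) (simp_all add: that x_0 x_Suc)
  interpret R: random_bregman_projections \<phi> M I Cs \<xi> \<xi>s x0 c0 x
    using Cs Cs_meas xi xis_indep xis_distr x0 c0 path
    by unfold_locales (auto simp: U_def C_def)
  note C_def [simp] U_def [simp]
  have mean: "\<forall>y\<in>U. mean_bregman_dist \<phi> M Cs \<xi> y < \<infinity>"
    using R.mean_finite by simp
  have cpt: "\<exists>K. compact K \<and> (AE \<omega> in M. \<forall>k. x k \<omega> \<in> K)"
  proof (intro exI conjI)
    show "compact R.start_sublevel" by (rule R.start_sublevel)
    show "AE \<omega> in M. \<forall>k. x k \<omega> \<in> R.start_sublevel"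
      using R.AE_fejer AE_space by eventually_elim (use R.fejer_bound in blast)
  qed
  have lim: "AE \<omega> in M. R.xhat \<omega> \<in> C \<inter> U" "AE \<omega> in M. (\<lambda>k. x k \<omega>) \<longlonglongrightarrow> R.xhat \<omega>"
    using R.AE_converges by (auto elim: eventually_mono)
  have distr: "\<exists>xhat \<in> borel_measurable M. \<exists>n. strict_mono n \<and>
      (AE \<omega> in M. xhat \<omega> \<in> C \<inter> U) \<and> converges_in_distribution M (\<lambda>k. x (n k)) xhat"
    using lim R.converges_in_distribution_xhat R.xhat_measurable
    by (intro bexI[of _ R.xhat] exI[of _ "\<lambda>k. k"]) (auto simp: strict_mono_def)
  have strong: "\<exists>xhat \<in> borel_measurable M. (AE \<omega> in M. xhat \<omega> \<in> U \<inter> C) \<and>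
      (AE \<omega> in M. (\<lambda>k. x k \<omega>) \<longlonglongrightarrow> xhat \<omega>) \<and>
      (\<lambda>k. \<integral>\<^sup>+ \<omega>. ennreal ((norm (x k \<omega> - xhat \<omega>))\<^sup>2) \<partial>M) \<longlonglongrightarrow> 0"
    using lim R.square_mean_convergence R.xhat_measurable
    by (intro bexI[of _ R.xhat] conjI) (auto simp: Int_commute)
  show ?thesis
    by (intro conjI allI impI mean cpt distr strong R.x_measurable R.AE_mean_tendsto
        R.AE_fejer[folded C_def] R.AE_decseq_dist[folded C_def] R.AE_dist_tendsto[folded C_def]
        R.expectation_dist_tendsto[folded C_def])
qed

end
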